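(* Let $n \geqslant 11$, let $3 \leqslant k \leqslant n-1$, let $T$ be a strongly connected tournament of order $k$ and let $a$ be an arrow of $T$. Then $$\mathrm{P}_\sigma(\mathcal{H}_n(T,k,a)) \leqslant \mathrm{P}_\sigma(\mathcal{H}_n(k)) \qquad\text{and}\qquad \mathrm{P}_\sigma(\mathcal{H}_n(k)) \leqslant \mathrm{P}_\sigma(\mathcal{H}_n(k^* )),$$ and equality holds in the second inequality if and only if $k = k^*$.
   Context: Digraphs are simple. For a strongly connected digraph $G$, $|x,y|_G$ is the length of a shortest directed path from $x$ to $y$ and the transmission is $\sigma(G)=\sum_{x\neq y}|x,y|_G$ over ordered pairs. The symmetric version $\overline{G}$ of $G=(V,A)$ has arrow $(i,j)$ iff $(i,j)\in A$ or $(j,i)\in A$. The price of symmetrisation is $\mathrm{P}_\sigma(G) = |\sigma(G)-\sigma(\overline{G})|$. A tournament has exactly one of $(i,j),(j,i)$ for every pair of distinct vertices. For a tournament $T$ of order $k$ with $3\leqslant k\leqslant n-1$ and an arrow $a=(u,w)$ of $T$, the bag $\mathcal{H}_n(T,k,a)$ is the digraph of order $n$ obtained from $T$ by adding $n-k$ new vertices $p_1,\dots,p_{n-k}$ and the arrows of the directed path $u\to p_1\to\cdots\to p_{n-k}\to w$ (a path of length $n-k+1$ parallel to $a$). The backward tournament $\mathcal{B}_k$ has vertices $v_1,\dots,v_k$ and arrows $(v_i,v_{i+1})$ for $1\leqslant i\leqslant k-1$ and $(v_i,v_j)$ for $3\leqslant i\leqslant k$, $1\leqslant j\leqslant i-2$;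 $\mathcal{H}_n(k)$ denotes $\mathcal{H}_n(\mathcal{B}_k,k,(v_k,v_1))$. Let $r = n(\sqrt{2}-1) + 8 - \frac{11\sqrt{2}}{2}$, and let $k^*$ be the element of $\{\lfloor r\rfloor, \lceil r\rceil\}$ for which $\mathrm{P}_\sigma(\mathcal{H}_n(k^* ))$ is the larger.
   Formalization: For some n (e.g. n = 13, k = 5, 6) floor and ceiling of r give equal prices, so k* is not unique; here k* is any maximiser of the two, equality holds iff k is such a maximiser, and "iff k = k*" is stated when k* is unique. *)

theory Defs
  imports Complex_Main "Graph_Theory.Graph_Theory"
begin

(* If no directed path from x to y exists, the value is unspecified; it is only of interest for
   strongly connected digraphs. *)
definition path_dist :: "'a pair_pre_digraph \<Rightarrow> 'a \<Rightarrow> 'a \<Rightarrow> nat" where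
  "path_dist G x y = (LEAST d. \<exists>p. pre_digraph.apath (with_proj G) x p y \<and> length p = d)"

definition transmission :: "'a pair_pre_digraph \<Rightarrow> nat" where
  "transmission G = (\<Sum>(x, y) \<in> {(x, y). x \<in> pverts G \<and> y \<in> pverts G \<and> x \<noteq> y}. path_dist G x y)"

definition price_of_symmetrisation :: "'a pair_pre_digraph \<Rightarrow> int" where
  "price_of_symmetrisation G =
     \<bar>int (transmission G) - int (transmission (mk_symmetric (with_proj G)))\<bar>"

(* Loops are excluded by pair_digraph, so the condition on distinct vertices determines all arcs. *)
definition tournament :: "'a pair_pre_digraph \<Rightarrow> bool" where
  "tournament T \<longleftrightarrow> pair_digraph T \<and>
     (\<forall>u \<in> pverts T. \<forall>v \<in> pverts T. u \<noteq> v \<longrightarrow> ((u, v) \<in> parcs T) \<noteq> ((v, u) \<in> parcs T))"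

(* Inl embeds the vertices of T and Inr i is the new vertex p_i, for 1 <= i <= n - k.
   The arrow a itself is kept. Meant for k = card (pverts T) and k < n. *)
definition bag :: "nat \<Rightarrow> 'a pair_pre_digraph \<Rightarrow> nat \<Rightarrow> 'a \<times> 'a \<Rightarrow> ('a + nat) pair_pre_digraph" where
  "bag n T k a =
     \<lparr> pverts = Inl ` pverts T \<union> Inr ` {1..n - k},
       parcs = map_prod Inl Inl ` parcs T
             \<union> {(Inl (fst a), Inr 1)}
             \<union> {(Inr i, Inr (i + 1)) | i. 1 \<le> i \<and> i < n - k}
             \<union> {(Inr (n - k), Inl (snd a))} \<rparr>"

definition backward_tournament :: "nat \<Rightarrow> nat pair_pre_digraph" where
  "backward_tournament k =
     \<lparr> pverts = {1..k},
       parcs = {(i, i + 1) | i. 1 \<le> i \<and> i \<le> k - 1}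
             \<union> {(i, j) | i j. 3 \<le> i \<and> i \<le> k \<and> 1 \<le> j \<and> j \<le> i - 2} \<rparr>"

definition backward_bag :: "nat \<Rightarrow> nat \<Rightarrow> (nat + nat) pair_pre_digraph" where
  "backward_bag n k = bag n (backward_tournament k) k (k, 1)"

definition r_opt :: "nat \<Rightarrow> real" where
  "r_opt n = real n * (sqrt 2 - 1) + 8 - 11 * sqrt 2 / 2"

(* A predicate rather than a function: for some n (e.g. n = 13, 18, 25, 54) the floor and the
   ceiling of r_opt n give the same price, and then both are k_star. *)
definition is_k_star :: "nat \<Rightarrow> nat \<Rightarrow> bool" where
  "is_k_star n k \<longleftrightarrow>
     is_arg_max (\<lambda>j. price_of_symmetrisation (backward_bag n j))
       (\<lambda>j. j \<in> {nat \<lfloor>r_opt n\<rfloor>, nat \<lceil>r_opt n\<rceil>}) k"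

end

(* Write m = n - k and a = (u, w). All shortest paths of the bag can be listed, so that its
   transmission is the transmission of T plus m times (sum of the distances to u plus sum of the
   distances from w) plus binom(m, 2) d(w, u) plus a function of k and m. In the symmetrised bag
   T becomes a complete graph, so the transmission there depends on k and m only. All four
   T-dependent quantities are largest for the backward tournament: the in- and out-distances of a
   vertex take values without gaps, and for the transmission one removes a vertex v that leaves
   the tournament strong (Moon) and bounds the distances to and from v.

   The price for the backward tournament is then an explicit cubic in k with a correction that
   depends on the parity of m. Its increment from k to k + 1 is positive as long as
   k + 1 <= r_opt n and negative as soon as r_opt n <= k, whatever the parity. *)
theory Submission
  imports Defs
begin

section \<open>Distances in relations\<close>

text \<open>Distances are handled through powers of the arc relation: walks compose freely, and a
  lower bound needs only a potential, an integer function that grows by at most 1 along every arc.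
  Each distance formula for the bags is certified by a walk and a potential, the claimed distances
  themselves serving as the potential, so paths are never enumerated.

  The quantities that depend on \<open>T\<close> enter the price with nonnegative coefficients.
  Bounding each of them separately therefore loses nothing, provided that one tournament with one
  arrow attains all the bounds together. The arrow \<open>(k, 1)\<close> of the backward tournament
  does this, because indices can only be climbed one at a time.

  The slope sqrt 2 - 1 of \<open>r_opt\<close> is a balance of leading terms: six times the
  increment of the price is 3/2 m^2 - 3 k^2 up to linear terms, which changes sign near m = sqrt 2
  k, that is, near k = (sqrt 2 - 1) n.\<close>

definition rdist :: "('a \<times> 'a) set \<Rightarrow> 'a \<Rightarrow> 'a \<Rightarrow> nat" where
  "rdist E x y = (LEAST n. (x, y) \<in> E ^^ n)"

lemma rdist_le: "(x, y) \<in> E ^^ n \<Longrightarrow> rdist E x y \<le> n"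
  unfolding rdist_def by (rule Least_le)

lemma rdist_relpow: "(x, y) \<in> E\<^sup>* \<Longrightarrow> (x, y) \<in> E ^^ rdist E x y"
  unfolding rdist_def by (auto dest!: rtrancl_imp_relpow intro: LeastI)

lemma rdist_self [simp]: "rdist E x x = 0"
  using rdist_le[of x x 0 E] by simp

lemma rdist_pos: "(x, y) \<in> E\<^sup>* \<Longrightarrow> x \<noteq> y \<Longrightarrow> 0 < rdist E x y"
  using rdist_relpow[of x y E] by (cases "rdist E x y") auto

lemma rdist_arc: "(x, y) \<in> E \<Longrightarrow> x \<noteq> y \<Longrightarrow> rdist E x y = 1"
  using rdist_le[of x y 1 E] rdist_pos[of x y E] by fastforce

lemma rdist_ge_2:
  assumes "(x, y) \<in> E\<^sup>*" "x \<noteq> y" "(x, y) \<notin> E"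
  shows "2 \<le> rdist E x y"
proof (rule ccontr)
  assume "\<not> 2 \<le> rdist E x y"
  with rdist_pos[OF assms(1,2)] have "rdist E x y = 1" by simp
  with rdist_relpow[OF assms(1)] assms(3) show False by simp
qed

lemma rdist_step:
  assumes "(x, y) \<in> E\<^sup>*" "(y, z) \<in> E"
  shows "rdist E x z \<le> rdist E x y + 1"
  using rdist_le[OF relpow_Suc_I[OF rdist_relpow[OF assms(1)] assms(2)]] by simp

lemma rdist_pred:
  assumes "(x, y) \<in> E\<^sup>*" "rdist E x y = Suc n"
  obtains z where "(z, y) \<in> E" "(x, z) \<in> E\<^sup>*" "rdist E x z = n"
proof -
  from rdist_relpow[OF assms(1)] assms(2) obtain z where z: "(x, z) \<in> E ^^ n" "(z, y) \<in> E"
    by auto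
  have xz: "(x, z) \<in> E\<^sup>*" using z(1) by (rule relpow_imp_rtrancl)
  have "rdist E x z = n"
    using rdist_le[OF z(1)] rdist_step[OF xz z(2)] assms(2) by simp
  with that z(2) xz show ?thesis by blast
qed

lemma relpow_map:
  assumes "\<And>a b. (a, b) \<in> E \<Longrightarrow> (h a, h b) \<in> H" "(x, y) \<in> E ^^ n"
  shows "(h x, h y) \<in> H ^^ n"
  using assms(2)
proof (induction n arbitrary: y)
  case (Suc n)
  then obtain z where "(x, z) \<in> E ^^ n" "(z, y) \<in> E" by auto
  with Suc.IH assms(1) show ?case by auto
qed simp

lemma rdist_antimono:
  assumes "F \<subseteq> E" "(x, y) \<in> F\<^sup>*"
  shows "rdist E x y \<le> rdist F x y"
  using relpow_map[where h = "\<lambda>z. z", OF _ rdist_relpow[OF assms(2)]] assms(1)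
  by (blast intro: rdist_le)

lemma relpow_converse: "((E :: ('a \<times> 'a) set)\<inverse>) ^^ n = (E ^^ n)\<inverse>"
proof (induction n)
  case (Suc n)
  have "(E\<inverse>) ^^ Suc n = (E ^^ n)\<inverse> O E\<inverse>" by (simp add: Suc.IH)
  also have "\<dots> = (E O E ^^ n)\<inverse>" by (simp add: converse_relcomp)
  also have "\<dots> = (E ^^ Suc n)\<inverse>" by (simp only: relpow_commute relpow.simps)
  finally show ?case .
qed auto

lemma rdist_converse: "rdist (E\<inverse>) x y = rdist E y x"
  unfolding rdist_def relpow_converse by simp

lemma relpow_chain:
  assumes "\<And>i. a \<le> i \<Longrightarrow> i < a + l \<Longrightarrow> (g i, g (Suc i)) \<in> H"
  shows "(g a, g (a + l)) \<in> H ^^ l"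
  using assms by (induction l) auto

text \<open>A potential must climb from \<open>f x\<close> to \<open>f y\<close> in steps of at most
  1, which bounds every walk from below. Integer values keep differences meaningful where the
  potential drops.\<close>

lemma potential_le_relpow:
  fixes f :: "'a \<Rightarrow> int"
  assumes "\<And>a b. (a, b) \<in> E \<Longrightarrow> f b \<le> f a + 1" "(x, y) \<in> E ^^ n"
  shows "f y - f x \<le> int n"
  using assms(2)
proof (induction n arbitrary: y)
  case (Suc n)
  then obtain z where "(x, z) \<in> E ^^ n" "(z, y) \<in> E" by auto
  with Suc.IH[of z] assms(1)[of z y] show ?case by auto
qed simp

lemma potential_le_rdist:
  fixes f :: "'a \<Rightarrow> int"
  assumes "\<And>a b. (a, b) \<in> E \<Longrightarrow> f b \<le> f a + 1" "(x, y) \<in> E\<^sup>*"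
  shows "f y - f x \<le> int (rdist E x y)"
  using assms(1) rdist_relpow[OF assms(2)] by (rule potential_le_relpow)

lemma rdist_eqI:
  fixes f :: "'a \<Rightarrow> int"
  assumes "(x, y) \<in> E ^^ n" "\<And>a b. (a, b) \<in> E \<Longrightarrow> f b \<le> f a + 1" "int n \<le> f y - f x"
  shows "rdist E x y = n"
proof -
  have "f y - f x \<le> int (rdist E x y)"
    using assms(2) relpow_imp_rtrancl[OF assms(1)] by (rule potential_le_rdist)
  with rdist_le[OF assms(1)] assms(3) show ?thesis by linarith
qed

text \<open>Diagonal pairs are included because they contribute 0; the double sum can then be cut
  into rows, columns and blocks.\<close>

definition total_dist :: "'a set \<Rightarrow> ('a \<times> 'a) set \<Rightarrow> nat" where
  "total_dist V E = (\<Sum>x\<in>V. \<Sum>y\<in>V. rdist E x y)"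

definition strong_on :: "'a set \<Rightarrow> ('a \<times> 'a) set \<Rightarrow> bool" where
  "strong_on V E \<longleftrightarrow> finite V \<and> E \<subseteq> V \<times> V \<and> (\<forall>x\<in>V. \<forall>y\<in>V. (x, y) \<in> E\<^sup>*)"

lemma strong_on_converse: "strong_on V (E\<inverse>) \<longleftrightarrow> strong_on V E"
  unfolding strong_on_def by (auto simp: rtrancl_converse)

section \<open>Agreement with path distances and the transmission\<close>

lemma (in pair_wf_digraph) awalk_relpow:
  assumes "awalk x p y" shows "(x, y) \<in> parcs G ^^ length p"
  using assms
proof (induction p arbitrary: x)
  case (Cons e p)
  then have e: "(x, snd e) \<in> parcs G" "awalk (snd e) p y"
    by (auto simp: awalk_Cons_iff)
  from relpow_Suc_I2[OF e(1) Cons.IH[OF e(2)]] show ?case by simp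
qed (auto simp: awalk_Nil_iff)

lemma (in pair_wf_digraph) relpow_awalk:
  assumes "(x, y) \<in> parcs G ^^ n" "x \<in> pverts G"
  shows "\<exists>p. awalk x p y \<and> length p = n"
  using assms
proof (induction n arbitrary: y)
  case 0
  then show ?case by (auto simp: awalk_Nil_iff)
next
  case (Suc n)
  then obtain z where z: "(x, z) \<in> parcs G ^^ n" "(z, y) \<in> parcs G" by auto
  with Suc obtain p where "awalk x p z" "length p = n" by blast
  moreover have "awalk z [(z, y)] y" using z(2) by (auto simp: awalk_def dest: wellformed')
  ultimately show ?case by (intro exI[of _ "p @ [(z, y)]"]) auto
qed

text \<open>\<open>path_dist\<close> minimises over paths, \<open>rdist\<close> over walks. A
  shortest walk repeats no vertex, since cutting out a closed piece would shorten it, so the minima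
  agree.\<close>

lemma (in pair_wf_digraph) path_dist_eq_rdist:
  assumes "x \<in> pverts G" "(x, y) \<in> (parcs G)\<^sup>*"
  shows "path_dist G x y = rdist (parcs G) x y"
proof -
  from relpow_awalk[OF rdist_relpow[OF assms(2)] assms(1)]
  obtain p where p: "awalk x p y" "length p = rdist (parcs G) x y" by blast
  have lb: "rdist (parcs G) x y \<le> length q" if "apath x q y" for q
    using that by (intro rdist_le awalk_relpow awalkI_apath)
  have "distinct (awalk_verts x p)"
  proof (rule ccontr)
    assume "\<not> distinct (awalk_verts x p)"
    with awalk_not_distinct_decomp[OF p(1)] obtain q r s w
      where "p = q @ r @ s" "0 < length r" "awalk x q w" "awalk w s y" by auto
    then have "awalk x (q @ s) y" "length (q @ s) < length p" by auto
    with rdist_le[OF awalk_relpow[of x "q @ s" y]] p(2) show False by simp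
  qed
  with p have "apath x p y" by (simp add: apath_def)
  with lb p(2) show ?thesis
    unfolding path_dist_def by (intro Least_equality) auto
qed

lemma transmission_eq_total_dist:
  assumes "strong_on (pverts G) (parcs G)"
  shows "transmission G = total_dist (pverts G) (parcs G)"
proof -
  let ?V = "pverts G"
  interpret pair_wf_digraph G
    using assms by unfold_locales (auto simp: strong_on_def)
  have fin: "finite ?V" using assms by (simp add: strong_on_def)
  have "transmission G = (\<Sum>(x, y) \<in> {(x, y). x \<in> ?V \<and> y \<in> ?V \<and> x \<noteq> y}. rdist (parcs G) x y)"
    unfolding transmission_def
    using assms by (intro sum.cong) (auto simp: strong_on_def path_dist_eq_rdist)
  also have "\<dots> = (\<Sum>(x, y) \<in> ?V \<times> ?V. rdist (parcs G) x y)"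
    using fin by (intro sum.mono_neutral_left) auto
  finally show ?thesis by (simp add: total_dist_def sum.cartesian_product)
qed

section \<open>Strong tournaments\<close>

definition strong_tour :: "'a set \<Rightarrow> ('a \<times> 'a) set \<Rightarrow> bool" where
  "strong_tour V E \<longleftrightarrow> strong_on V E \<and> (\<forall>x y. (x, y) \<in> E \<longrightarrow> (y, x) \<notin> E) \<and>
     (\<forall>x\<in>V. \<forall>y\<in>V. x \<noteq> y \<longrightarrow> (x, y) \<in> E \<or> (y, x) \<in> E)"

lemma strong_tour_converse: "strong_tour V E \<Longrightarrow> strong_tour V (E\<inverse>)"
  unfolding strong_tour_def strong_on_converse by blast

text \<open>Descending from \<open>f a\<close> in steps of 1 meets every value down to
  \<open>c\<close>, so \<open>A\<close> has at least as many elements as \<open>{c..f a}\<close>.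
  The threshold \<open>c\<close> is 0 for distances over all vertices and 2 for distances to the
  in-neighbours of the source.\<close>

lemma gapfree_less:
  fixes f :: "'a \<Rightarrow> nat"
  assumes "finite A" "\<And>b. b \<in> A \<Longrightarrow> c < f b \<Longrightarrow> \<exists>b'\<in>A. Suc (f b') = f b" "a \<in> A"
  shows "f a < c + card A"
proof -
  have attained: "f a - j \<in> f ` A" if "c + j \<le> f a" for j
    using that
  proof (induction j)
    case (Suc j)
    then obtain b where b: "b \<in> A" "f b = f a - j" by auto
    then have "c < f b" using Suc.prems by simp
    with assms(2)[OF b(1)] obtain b' where "b' \<in> A" "Suc (f b') = f b" by auto
    with b show ?case by (intro rev_image_eqI[of b']) auto
  qed (use assms(3) in auto)
  have "t \<in> f ` A" if "t \<in> {c..f a}" for t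
  proof -
    have "c + (f a - t) \<le> f a" "f a - (f a - t) = t" using that by auto
    with attained[of "f a - t"] show ?thesis by simp
  qed
  then have "{c..f a} \<subseteq> f ` A" by blast
  then have "card {c..f a} \<le> card A"
    using assms(1) by (meson card_image_le card_mono finite_imageI le_trans)
  then show ?thesis by simp
qed

text \<open>An element of largest value is nobody's predecessor, so removing it preserves the
  hypothesis, and \<open>gapfree_less\<close> bounds its value. In the extreme case each of
  \<open>c\<close>, \<open>c + 1\<close>, ... is taken once.\<close>

lemma gapfree_sum_le:
  fixes f :: "'a \<Rightarrow> nat"
  assumes "finite A" "\<And>b. b \<in> A \<Longrightarrow> c < f b \<Longrightarrow> \<exists>b'\<in>A. Suc (f b') = f b"
  shows "sum f A \<le> (\<Sum>i<card A. c + i)"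
  using assms
proof (induction "card A" arbitrary: A)
  case (Suc n)
  then have "f ` A \<noteq> {}" "finite (f ` A)" by auto
  then obtain a where a: "a \<in> A" "f a = Max (f ` A)" by (metis Max_in imageE)
  have max: "f b \<le> f a" if "b \<in> A" for b using that a Suc.prems(1) by simp
  have card: "card (A - {a}) = n" using Suc a by simp
  have "sum f (A - {a}) \<le> (\<Sum>i<card (A - {a}). c + i)"
  proof (rule Suc.hyps(1))
    fix b assume b: "b \<in> A - {a}" "c < f b"
    with Suc.prems(2)[of b] obtain b' where b': "b' \<in> A" "Suc (f b') = f b" by auto
    with max[of b] b have "b' \<noteq> a" by auto
    with b' show "\<exists>b'\<in>A - {a}. Suc (f b') = f b" by blast
  qed (use card Suc.prems in auto)
  moreover have "f a \<le> c + n"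
    using gapfree_less[of A c f a, OF Suc.prems a(1)] Suc.hyps(2) by simp
  ultimately show ?case
    using a Suc.prems(1) Suc.hyps(2) card by (simp add: sum.remove Suc.hyps(2)[symmetric])
qed simp

lemma double_sum_lessThan_add: "2 * (\<Sum>i<n. c + i) + n = n * (2 * c + n)" for c n :: nat
  by (induction n) (auto simp: algebra_simps)

lemma strong_on_gapfree:
  assumes "strong_on V E" "v \<in> V" "b \<in> V" "0 < rdist E v b"
  shows "\<exists>b'\<in>V. Suc (rdist E v b') = rdist E v b"
proof -
  have vb: "(v, b) \<in> E\<^sup>*" using assms by (auto simp: strong_on_def)
  from assms(4) obtain n where n: "rdist E v b = Suc n" by (metis gr0_implies_Suc)
  from rdist_pred[OF vb n] obtain z where "(z, b) \<in> E" "rdist E v z = n" by blast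
  with n assms(1) show ?thesis by (auto simp: strong_on_def)
qed

lemma strong_on_rdist_less:
  assumes "strong_on V E" "v \<in> V" "w \<in> V"
  shows "rdist E v w < card V"
  using gapfree_less[of V 0 "rdist E v" w] strong_on_gapfree[OF assms(1,2)] assms
  by (auto simp: strong_on_def)

text \<open>The extreme case has one vertex at each distance from 0 to \<open>card V - 1\<close>.
  Doubling and moving \<open>card V\<close> to the left avoids division and truncated
  subtraction.\<close>

lemma strong_on_out_sum_le:
  assumes "strong_on V E" "v \<in> V"
  shows "2 * (\<Sum>y\<in>V. rdist E v y) + card V \<le> card V * card V"
  using gapfree_sum_le[of V 0 "rdist E v"] strong_on_gapfree[OF assms] assms
    double_sum_lessThan_add[of 0 "card V"]
  by (auto simp: strong_on_def)

lemma strong_on_in_sum_le: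
  assumes "strong_on V E" "v \<in> V"
  shows "2 * (\<Sum>y\<in>V. rdist E y v) + card V \<le> card V * card V"
  using strong_on_out_sum_le[of V "E\<inverse>" v] assms
  by (simp add: rdist_converse strong_on_converse)

lemma rtrancl_leaves:
  assumes "(x, y) \<in> E\<^sup>*" "x \<in> A" "y \<notin> A"
  obtains p q where "(p, q) \<in> E" "p \<in> A" "q \<notin> A"
  using assms by (induction rule: rtrancl_induct) auto

section \<open>Distances at a single vertex of a strong tournament\<close>

lemma tour_vertex_partition:
  assumes T: "strong_tour V E" and v: "v \<in> V" and k: "2 \<le> card V"
  defines "P \<equiv> {y \<in> V. (v, y) \<in> E}" and "Q \<equiv> {y \<in> V. (y, v) \<in> E}"
  shows "V = insert v (P \<union> Q)" "v \<notin> P" "v \<notin> Q" "P \<inter> Q = {}" "finite P" "finite Q"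
    "card V = Suc (card P + card Q)" "0 < card P" "0 < card Q"
proof -
  have fin: "finite V" and sub: "E \<subseteq> V \<times> V" using T by (auto simp: strong_tour_def strong_on_def)
  have asym: "\<And>y. (v, y) \<in> E \<Longrightarrow> (y, v) \<in> E \<Longrightarrow> False"
    and total: "\<And>y. y \<in> V \<Longrightarrow> y \<noteq> v \<Longrightarrow> (v, y) \<in> E \<or> (y, v) \<in> E"
    using T v unfolding strong_tour_def by blast+
  show eq: "V = insert v (P \<union> Q)" and nv: "v \<notin> P" "v \<notin> Q" and dj: "P \<inter> Q = {}"
    and fin2: "finite P" "finite Q"
    using v fin by (auto simp: P_def Q_def dest: asym total)
  then have "card V = card (insert v (P \<union> Q))" by simp
  also have "\<dots> = Suc (card P + card Q)" using nv dj fin2 by (simp add: card_Un_disjoint)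
  finally show "card V = Suc (card P + card Q)" .
  have "V \<noteq> {v}" using k by auto
  with v obtain z where z: "z \<in> V" "z \<noteq> v" by blast
  then have "(v, z) \<in> E\<^sup>*" "(z, v) \<in> E\<^sup>*" using T v by (auto simp: strong_tour_def strong_on_def)
  then obtain p q where "(v, p) \<in> E" "(q, v) \<in> E"
    using z by (metis converse_rtranclE rtranclE)
  then have "p \<in> P" "q \<in> Q" using sub by (auto simp: P_def Q_def)
  then show "0 < card P" "0 < card Q" using fin2 by (auto simp: card_gt_0_iff)
qed

text \<open>Out-neighbours are at distance 1. Every vertex at distance at least 2 is an
  in-neighbour, so the distances to the in-neighbours have no gaps above 2.\<close>

lemma tour_out_sum_le:
  assumes T: "strong_tour V E" and v: "v \<in> V" and k: "2 \<le> card V"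
  defines "P \<equiv> {y \<in> V. (v, y) \<in> E}" and "Q \<equiv> {y \<in> V. (y, v) \<in> E}"
  shows "(\<Sum>y\<in>V. rdist E v y) \<le> card P + (\<Sum>i<card Q. 2 + i)"
proof -
  note part = tour_vertex_partition[OF T v k, folded P_def Q_def]
  have S: "strong_on V E" using T by (simp add: strong_tour_def)
  have reach: "(v, y) \<in> E\<^sup>*" if "y \<in> V" for y using that S v by (auto simp: strong_on_def)
  have "(\<Sum>y\<in>V. rdist E v y) = (\<Sum>y\<in>P. rdist E v y) + (\<Sum>y\<in>Q. rdist E v y)"
    using part by (metis sum.insert sum.union_disjoint finite_UnI Un_iff rdist_self add_0)
  moreover have "(\<Sum>y\<in>P. rdist E v y) = (\<Sum>y\<in>P. 1)"
    using part(2) by (intro sum.cong refl rdist_arc) (auto simp: P_def)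
  moreover have "(\<Sum>y\<in>Q. rdist E v y) \<le> (\<Sum>i<card Q. 2 + i)"
  proof (rule gapfree_sum_le[OF part(6)])
    fix b assume b: "b \<in> Q" "2 < rdist E v b"
    then have "b \<in> V" by (simp add: Q_def)
    with strong_on_gapfree[OF S v] b obtain z where z: "z \<in> V" "Suc (rdist E v z) = rdist E v b"
      by fastforce
    with b have "2 \<le> rdist E v z" by simp
    then have "z \<noteq> v" by auto
    with \<open>2 \<le> rdist E v z\<close> have "z \<notin> P" using rdist_arc[of v z E] by (auto simp: P_def)
    with z \<open>z \<noteq> v\<close> part(1) show "\<exists>b'\<in>Q. Suc (rdist E v b') = rdist E v b" by blast
  qed
  ultimately show ?thesis by simp
qed

lemma tour_vertex_sum_le:
  assumes T: "strong_tour V E" and v: "v \<in> V" and k: "2 \<le> card V"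
  shows "2 * ((\<Sum>y\<in>V. rdist E v y) + (\<Sum>y\<in>V. rdist E y v)) \<le> card V * Suc (card V)"
proof -
  define p q where "p = card {y \<in> V. (v, y) \<in> E}" and "q = card {y \<in> V. (y, v) \<in> E}"
  have card: "card V = Suc (p + q)" and pos: "0 < p" "0 < q"
    using tour_vertex_partition[OF T v k] by (simp_all add: p_def q_def)
  have "(\<Sum>y\<in>V. rdist E v y) \<le> p + (\<Sum>i<q. 2 + i)"
    using tour_out_sum_le[OF T v k] by (simp add: p_def q_def)
  moreover have "(\<Sum>y\<in>V. rdist E y v) \<le> q + (\<Sum>i<p. 2 + i)"
    using tour_out_sum_le[OF strong_tour_converse[OF T] v k]
    by (simp add: p_def q_def rdist_converse)
  moreover note double_sum_lessThan_add[of 2 q] double_sum_lessThan_add[of 2 p]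
  \<comment> \<open>The right side exceeds twice the sum of the two bounds by
    \<open>2 * p' * q'\<close>; here it matters that both degrees are positive.\<close>
  moreover obtain p' q' where "p = Suc p'" "q = Suc q'"
    using pos by (metis gr0_implies_Suc)
  ultimately show ?thesis unfolding card by (simp add: algebra_simps)
qed

section \<open>Deleting a vertex of a strong tournament\<close>

lemma strong_hub:
  assumes "\<And>x. x \<in> S \<Longrightarrow> (h, x) \<in> R\<^sup>* \<and> (x, h) \<in> R\<^sup>*"
  shows "\<forall>x\<in>S. \<forall>y\<in>S. (x, y) \<in> R\<^sup>*"
  using assms by (blast intro: rtrancl_trans)

text \<open>Moon's theorem: take a largest strong proper vertex subset. If it misses more than one
  vertex, then every missing vertex dominates it or is dominated by it, and an arc from the
  dominated to the dominating ones yields a larger strong proper subset.\<close>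

lemma strong_tour_remove:
  assumes T: "strong_tour V E" and k: "4 \<le> card V"
  obtains v where "v \<in> V" "strong_tour (V - {v}) (E \<inter> (V - {v}) \<times> (V - {v}))"
proof -
  define str where "str S \<longleftrightarrow> (\<forall>x\<in>S. \<forall>y\<in>S. (x, y) \<in> (E \<inter> S \<times> S)\<^sup>*)" for S
  have fin: "finite V" and sub: "E \<subseteq> V \<times> V"
    and conn: "\<And>x y. x \<in> V \<Longrightarrow> y \<in> V \<Longrightarrow> (x, y) \<in> E\<^sup>*"
    and asym: "\<And>x y. (x, y) \<in> E \<Longrightarrow> (y, x) \<in> E \<Longrightarrow> False"
    and total: "\<And>x y. x \<in> V \<Longrightarrow> y \<in> V \<Longrightarrow> x \<noteq> y \<Longrightarrow> (x, y) \<in> E \<or> (y, x) \<in> E"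
    using T unfolding strong_tour_def strong_on_def by blast+
  define good where "good S \<longleftrightarrow> S \<subset> V \<and> S \<noteq> {} \<and> str S" for S
  obtain v where v: "v \<in> V" using k by fastforce
  have "good {v}" using v k by (auto simp: good_def str_def)
  then obtain S where S: "good S" and max: "\<And>S'. good S' \<Longrightarrow> card S' \<le> card S"
    using ex_has_greatest_nat[of good "{v}" card "Suc (card V)"] fin
    by (auto simp: good_def less_Suc_eq_le intro: card_mono)
  have SV: "S \<subset> V" "S \<noteq> {}" "str S" using S by (auto simp: good_def)
  have finS: "finite S" using SV fin by (meson finite_subset psubset_imp_subset)
  have less: "card S < card V" using SV fin by (simp add: psubset_card_mono)
  have "Suc (card S) = card V"
  proof (rule ccontr)
    assume "Suc (card S) \<noteq> card V"
    with less have less': "Suc (card S) < card V" by simp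
    have good_le: False if "S' \<subseteq> V" "card S < card S'" "card S' < card V" "str S'" for S'
    proof -
      have "S' \<noteq> V" "S' \<noteq> {}" using that by auto
      with that max[of S'] show False by (auto simp: good_def)
    qed
    define A B where "A = {z \<in> V - S. \<forall>s\<in>S. (s, z) \<in> E}" and "B = {z \<in> V - S. \<forall>s\<in>S. (z, s) \<in> E}"
    have AB: "z \<in> A \<union> B" if z: "z \<in> V - S" for z
    proof (rule ccontr)
      assume "z \<notin> A \<union> B"
      then obtain s t where st: "s \<in> S" "t \<in> S" "(s, z) \<notin> E" "(z, t) \<notin> E"
        using z by (auto simp: A_def B_def)
      then have st': "(z, s) \<in> E" "(t, z) \<in> E"
        using total[of s z] total[of t z] z SV by blast+
      let ?R = "E \<inter> insert z S \<times> insert z S"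
      have mono: "(x, y) \<in> ?R\<^sup>*" if "x \<in> S" "y \<in> S" for x y
      proof -
        have "(x, y) \<in> (E \<inter> S \<times> S)\<^sup>*" using that SV(3) by (simp add: str_def)
        then show ?thesis by (rule set_mp[OF rtrancl_mono, rotated]) auto
      qed
      have "(z, s) \<in> ?R" "(t, z) \<in> ?R" using st st' by auto
      then have zs: "(z, x) \<in> ?R\<^sup>*" "(x, z) \<in> ?R\<^sup>*" if "x \<in> S" for x
        using mono[OF st(1) that] mono[OF that st(2)]
        by (auto intro: converse_rtrancl_into_rtrancl rtrancl_into_rtrancl)
      have "str (insert z S)"
        unfolding str_def by (rule strong_hub[of _ z]) (use zs in auto)
      moreover have "card (insert z S) = Suc (card S)" using z finS by simp
      ultimately show False using good_le[of "insert z S"] less' z SV by auto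
    qed
    \<comment> \<open>An arc that leaves \<open>S\<close> ends in \<open>A\<close>. The way back to
      \<open>S\<close> has to leave \<open>A\<close>, and since no arc leads from \<open>A\<close>
      to \<open>S\<close>, it does so into \<open>B\<close>.\<close>
    obtain s z where s: "s \<in> S" and z: "z \<in> V" "z \<notin> S" using SV by blast
    have "(s, z) \<in> E\<^sup>*" using conn s z SV by blast
    then obtain s' q where q: "(s', q) \<in> E" "s' \<in> S" "q \<notin> S"
      using s z(2) by (rule rtrancl_leaves)
    have "q \<notin> B" using q asym[of s' q] by (auto simp: B_def)
    then have qA: "q \<in> A" using AB[of q] q sub by blast
    have "(q, s) \<in> E\<^sup>*" using conn[of q s] q sub s SV by blast
    moreover note qA
    moreover have "s \<notin> A" using s by (auto simp: A_def)
    ultimately obtain a b where ab: "(a, b) \<in> E" "a \<in> A" "b \<notin> A"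
      by (rule rtrancl_leaves)
    have "b \<notin> S" using ab asym[of a b] by (auto simp: A_def)
    then have bB: "b \<in> B" using AB[of b] ab sub by blast
    have cs: "0 < card S" "card (S - {s}) = card S - 1" using s finS by (auto simp: card_gt_0_iff)
    \<comment> \<open>Adding both \<open>a\<close> and \<open>b\<close> to \<open>S\<close> might
      exhaust \<open>V\<close>, so one vertex is given up; the result still has more vertices than
      \<open>S\<close>. A singleton is kept whole, as \<open>S'\<close> must be nonempty to lead
      from \<open>b\<close> to \<open>a\<close>; then \<open>4 \<le> card V\<close> leaves
      room.\<close>
    obtain S' where S': "S' \<subseteq> S" "S' \<noteq> {}" "card S \<le> Suc (card S')" "card S' + 2 < card V"
    proof (cases "card S = 1")
      case True
      with that[of S] SV k show ?thesis by simp
    next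
      case False
      with cs have "S - {s} \<noteq> {}" by (metis One_nat_def Suc_pred card.empty)
      with that[of "S - {s}"] cs less' show ?thesis by auto
    qed
    define U where "U = insert a (insert b S')"
    let ?R = "E \<inter> U \<times> U"
    have ne: "a \<noteq> b" "a \<notin> S'" "b \<notin> S'" using ab bB S' by (auto simp: A_def B_def)
    have cU: "card U = card S' + 2"
      using ne S'(1) finS by (simp add: U_def finite_subset)
    have arcs: "(a, b) \<in> ?R" "\<And>x. x \<in> S' \<Longrightarrow> (b, x) \<in> ?R" "\<And>x. x \<in> S' \<Longrightarrow> (x, a) \<in> ?R"
      using ab bB S' by (auto simp: U_def A_def B_def)
    obtain x0 where "x0 \<in> S'" using S' by blast
    then have ba: "(b, a) \<in> ?R\<^sup>*" using arcs by (meson r_into_rtrancl rtrancl_trans)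
    have "str U"
      unfolding str_def
    proof (rule strong_hub[of _ a])
      fix x assume "x \<in> U"
      then consider "x = a" | "x = b" | "x \<in> S'" by (auto simp: U_def)
      then show "(a, x) \<in> ?R\<^sup>* \<and> (x, a) \<in> ?R\<^sup>*"
      proof cases
        case 2
        then show ?thesis using ba r_into_rtrancl[OF arcs(1)] by simp
      next
        case 3
        then show ?thesis using arcs by (meson r_into_rtrancl rtrancl_trans)
      qed simp
    qed
    moreover have "U \<subseteq> V" using ab bB S' SV by (auto simp: U_def A_def B_def)
    moreover have "card S < card U" using cU S' by simp
    moreover have "card U < card V" using cU S'(4) by simp
    ultimately show False using good_le by blast
  qed
  then have "card (V - S) = 1" using SV fin finS by (simp add: card_Diff_subset)
  then obtain w where "V - S = {w}" by (auto simp: card_1_singleton_iff)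
  then have w: "w \<in> V" "S = V - {w}" using SV by auto
  have "strong_tour (V - {w}) (E \<inter> (V - {w}) \<times> (V - {w}))"
    using SV(3) fin asym total unfolding w str_def strong_tour_def strong_on_def by blast
  with w that show ?thesis by blast
qed

text \<open>The bound is the binomial coefficient C(k+2, 3) minus 1. Removing a vertex can only
  lengthen the remaining distances, and the row and column of that vertex cost at most C(k+1, 2), so
  Pascal's rule closes the induction. For three vertices, summing the bound at each vertex counts
  every distance twice and gives 9 = 10 - 1.\<close>

lemma strong_tour_total_dist_le:
  assumes "strong_tour V E" "3 \<le> card V"
  shows "6 * total_dist V E + 6 \<le> card V * (card V + 1) * (card V + 2)"
  using assms
proof (induction "card V" arbitrary: V E)
  case (Suc n)
  have fin: "finite V" using Suc.prems by (auto simp: strong_tour_def strong_on_def)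
  show ?case
  proof (cases "card V = 3")
    case True
    have "2 * ((\<Sum>y\<in>V. rdist E v y) + (\<Sum>y\<in>V. rdist E y v)) \<le> 12" if "v \<in> V" for v
      using tour_vertex_sum_le[OF Suc.prems(1) that] True by simp
    then have "(\<Sum>v\<in>V. 2 * ((\<Sum>y\<in>V. rdist E v y) + (\<Sum>y\<in>V. rdist E y v))) \<le> (\<Sum>v\<in>V. 12)"
      by (rule sum_mono)
    then have "2 * (total_dist V E + (\<Sum>v\<in>V. \<Sum>y\<in>V. rdist E y v)) \<le> 36"
      using True by (simp add: total_dist_def sum.distrib sum_distrib_left[symmetric])
    moreover have "(\<Sum>v\<in>V. \<Sum>y\<in>V. rdist E y v) = total_dist V E"
      unfolding total_dist_def by (rule sum.swap)
    ultimately show ?thesis using True by simp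
  next
    case False
    with Suc.prems have k: "4 \<le> card V" by simp
    from strong_tour_remove[OF Suc.prems(1) k] obtain v where v: "v \<in> V"
      and T': "strong_tour (V - {v}) (E \<inter> (V - {v}) \<times> (V - {v}))" (is "strong_tour ?W ?F") .
    have cW: "card ?W = n" using Suc.hyps(2) v fin by simp
    have IH: "6 * total_dist ?W ?F + 6 \<le> n * (n + 1) * (n + 2)"
      using Suc.hyps(1)[of ?W ?F] cW T' k Suc.hyps(2) by simp
    have split: "(\<Sum>y\<in>V. g y) = g v + (\<Sum>y\<in>?W. g y)" for g :: "'a \<Rightarrow> nat"
      using sum.remove[OF fin v] .
    have "total_dist V E = (\<Sum>y\<in>V. rdist E v y) + (\<Sum>x\<in>?W. rdist E x v + (\<Sum>y\<in>?W. rdist E x y))"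
      unfolding total_dist_def using split[of "\<lambda>x. \<Sum>y\<in>V. rdist E x y"] split[of "rdist E _"] by simp
    also have "\<dots> = ((\<Sum>y\<in>V. rdist E v y) + (\<Sum>y\<in>V. rdist E y v)) + (\<Sum>x\<in>?W. \<Sum>y\<in>?W. rdist E x y)"
      using split[of "\<lambda>x. rdist E x v"] by (simp add: sum.distrib)
    also have "(\<Sum>x\<in>?W. \<Sum>y\<in>?W. rdist E x y) \<le> total_dist ?W ?F"
      unfolding total_dist_def using T'
      by (intro sum_mono rdist_antimono) (auto simp: strong_tour_def strong_on_def)
    finally have "total_dist V E \<le>
      ((\<Sum>y\<in>V. rdist E v y) + (\<Sum>y\<in>V. rdist E y v)) + total_dist ?W ?F" by simp
    moreover have "2 * ((\<Sum>y\<in>V. rdist E v y) + (\<Sum>y\<in>V. rdist E y v)) \<le> Suc n * Suc (Suc n)"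
      using tour_vertex_sum_le[OF Suc.prems(1) v] k Suc.hyps(2) by simp
    ultimately have "6 * total_dist V E + 6 \<le> 3 * (Suc n * Suc (Suc n)) + n * (n + 1) * (n + 2)"
      using IH by (simp del: mult_Suc mult_Suc_right)
    also have "\<dots> = Suc n * (Suc n + 1) * (Suc n + 2)" by (simp add: algebra_simps)
    finally show ?thesis using Suc.hyps(2) by simp
  qed
qed simp

section \<open>The backward tournament\<close>

lemma tournament_strong_tour:
  assumes "tournament T" "strongly_connected (with_proj T)"
  shows "strong_tour (pverts T) (parcs T)"
proof -
  interpret pair_digraph T using assms(1) unfolding tournament_def by blast
  have total: "\<forall>x\<in>pverts T. \<forall>y\<in>pverts T. x \<noteq> y \<longrightarrow> ((x, y) \<in> parcs T) \<noteq> ((y, x) \<in> parcs T)"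
    using assms(1) unfolding tournament_def by blast
  have "(x, y) \<in> (parcs T)\<^sup>*" if "x \<in> pverts T" "y \<in> pverts T" for x y
  proof -
    have "x \<rightarrow>\<^sup>*\<^bsub>with_proj T\<^esub> y" using assms(2) that by (simp add: strongly_connected_def)
    then show ?thesis using reachable_rtranclI[of "with_proj T" x y] by simp
  qed
  moreover have "finite (pverts T)" "parcs T \<subseteq> pverts T \<times> pverts T"
    using pair_finite_verts by (auto dest: wellformed')
  moreover have "(y, x) \<notin> parcs T" if "(x, y) \<in> parcs T" for x y
    using that total wellformed'[OF that] pair_no_loops[OF that] by (metis fst_conv snd_conv)
  ultimately show ?thesis
    using total unfolding strong_tour_def strong_on_def by blast
qed

lemma backward_tournament_sel [simp]:
  "pverts (backward_tournament k) = {1..k}"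
  "(i, j) \<in> parcs (backward_tournament k) \<longleftrightarrow>
     1 \<le> i \<and> i < k \<and> j = i + 1 \<or> 3 \<le> i \<and> i \<le> k \<and> 1 \<le> j \<and> j + 2 \<le> i"
  by (auto simp: backward_tournament_def)

lemma backward_strong_tour:
  assumes "3 \<le> k"
  shows "strong_tour {1..k} (parcs (backward_tournament k))"
proof -
  let ?E = "parcs (backward_tournament k)"
  have up: "(i, j) \<in> ?E\<^sup>*" if "1 \<le> i" "i \<le> j" "j \<le> k" for i j
    using relpow_chain[of i "j - i" id ?E] that by (auto intro: relpow_imp_rtrancl)
  have "(k, 1) \<in> ?E" using assms by simp
  then have "(x, 1) \<in> ?E\<^sup>*" if "x \<in> {1..k}" for x
    using up[of x k] that by (auto intro: rtrancl_into_rtrancl)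
  then have "\<forall>x\<in>{1..k}. \<forall>y\<in>{1..k}. (x, y) \<in> ?E\<^sup>*"
    by (intro strong_hub[of _ 1]) (auto intro: up)
  moreover have "?E \<subseteq> {1..k} \<times> {1..k}" by (auto simp: subset_iff)
  ultimately show ?thesis using assms by (auto simp: strong_tour_def strong_on_def)
qed

text \<open>An arc raises the index by at most one, so the index is a potential. The only descending
  pairs without an arc are those of neighbouring indices.\<close>

lemma backward_rdist_ge:
  assumes "3 \<le> k" "i \<in> {1..k}" "j \<in> {1..k}"
  shows "(if i \<le> j then j - i else if i = Suc j then 2 else 1) \<le>
    rdist (parcs (backward_tournament k)) i j"
proof -
  let ?E = "parcs (backward_tournament k)"
  have reach: "(i, j) \<in> ?E\<^sup>*"
    using backward_strong_tour[OF assms(1)] assms(2,3) by (simp add: strong_tour_def strong_on_def)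
  have "int j - int i \<le> int (rdist ?E i j)"
    by (rule potential_le_rdist[OF _ reach]) auto
  moreover have "2 \<le> rdist ?E i j" if "i = Suc j"
    using rdist_ge_2[OF reach] that by simp
  moreover have "0 < rdist ?E i j" if "i \<noteq> j" using rdist_pos[OF reach that] .
  ultimately show ?thesis by auto
qed

lemma sum_atLeastAtMost_diff: "2 * (\<Sum>i = 1..k. k - i) + k = k * k" for k :: nat
proof (induction k)
  case (Suc k)
  have "(\<Sum>i = 1..Suc k. Suc k - i) = (\<Sum>i = 1..k. (k - i) + 1)"
    by (simp add: Suc_diff_le)
  also have "\<dots> = (\<Sum>i = 1..k. k - i) + k" by (simp only: sum.distrib) simp
  finally have "2 * (\<Sum>i = 1..Suc k. Suc k - i) + Suc k = (2 * (\<Sum>i = 1..k. k - i) + k) + (2 * k + 1)"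
    by simp
  also have "\<dots> = Suc k * Suc k" unfolding Suc.IH by simp
  finally show ?case .
qed simp

text \<open>Lower bounds on the single distances suffice: their sum already reaches the upper bound
  valid for all strong tournaments.\<close>

lemma backward_total_dist:
  assumes "3 \<le> k"
  shows "6 * total_dist {1..k} (parcs (backward_tournament k)) + 6 = k * (k + 1) * (k + 2)"
proof (rule antisym)
  show "6 * total_dist {1..k} (parcs (backward_tournament k)) + 6 \<le> k * (k + 1) * (k + 2)"
    using strong_tour_total_dist_le[OF backward_strong_tour[OF assms]] assms by simp
  \<comment> \<open>\<open>lb\<close> does not depend on \<open>k\<close>, so passing from
    \<open>n\<close> to \<open>Suc n\<close> only adds a last row and a last column to the
    table.\<close>
  define lb where "lb i j = (if i \<le> j then j - i else if i = Suc j then 2 else 1)" for i j :: nat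
  have lb: "1 \<le> n \<Longrightarrow> 6 * (\<Sum>i = 1..n. \<Sum>j = 1..n. lb i j) + 6 = n * (n + 1) * (n + 2)" for n
  proof (induction n rule: dec_induct)
    case (step n)
    have "(\<Sum>j = 1..n. lb (Suc n) j) = (\<Sum>j = 1..n. 1 + of_bool (j = n))"
      by (intro sum.cong) (auto simp: lb_def)
    also have "\<dots> = n + 1" using step(1) by (simp only: sum.distrib) (simp add: of_bool_def)
    finally have col: "(\<Sum>j = 1..n. lb (Suc n) j) = n + 1" .
    have row: "2 * (\<Sum>i = 1..n. lb i (Suc n)) = n * (n + 1)"
      using sum_atLeastAtMost_diff[of "Suc n"] by (simp add: lb_def)
    have "(\<Sum>i = 1..Suc n. \<Sum>j = 1..Suc n. lb i j) =
        (\<Sum>i = 1..n. (\<Sum>j = 1..n. lb i j) + lb i (Suc n)) + ((\<Sum>j = 1..n. lb (Suc n) j) + lb (Suc n) (Suc n))"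
      by simp
    also have "\<dots> = (\<Sum>i = 1..n. \<Sum>j = 1..n. lb i j) + (\<Sum>i = 1..n. lb i (Suc n)) + (n + 1)"
      by (simp only: col sum.distrib) (simp add: lb_def)
    finally have eq: "(\<Sum>i = 1..Suc n. \<Sum>j = 1..Suc n. lb i j) =
      (\<Sum>i = 1..n. \<Sum>j = 1..n. lb i j) + (\<Sum>i = 1..n. lb i (Suc n)) + (n + 1)" .
    have "6 * (\<Sum>i = 1..Suc n. \<Sum>j = 1..Suc n. lb i j) + 6 =
      (6 * (\<Sum>i = 1..n. \<Sum>j = 1..n. lb i j) + 6) + 3 * (2 * (\<Sum>i = 1..n. lb i (Suc n))) + 6 * (n + 1)"
      unfolding eq by simp
    also have "\<dots> = n * (n + 1) * (n + 2) + 3 * (n * (n + 1)) + 6 * (n + 1)"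
      by (simp only: row step.IH)
    finally show ?case by (simp add: algebra_simps)
  qed (simp add: lb_def)
  have "(\<Sum>i = 1..k. \<Sum>j = 1..k. lb i j) \<le> total_dist {1..k} (parcs (backward_tournament k))"
    unfolding total_dist_def lb_def by (intro sum_mono backward_rdist_ge assms)
  with lb[of k] assms
  show "k * (k + 1) * (k + 2) \<le> 6 * total_dist {1..k} (parcs (backward_tournament k)) + 6" by simp
qed

text \<open>For the arrow \<open>(k, 1)\<close>, the distances to its tail \<open>k\<close> and from
  its head 1 matter. Both are ascents in the index, so the general upper bounds are
  attained.\<close>

lemma backward_extreme_dists:
  assumes "3 \<le> k"
  shows "2 * (\<Sum>x = 1..k. rdist (parcs (backward_tournament k)) x k) + k = k * k"
    "2 * (\<Sum>y = 1..k. rdist (parcs (backward_tournament k)) 1 y) + k = k * k"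
    "rdist (parcs (backward_tournament k)) 1 k + 1 = k"
proof -
  let ?E = "parcs (backward_tournament k)"
  have S: "strong_on {1..k} ?E" using backward_strong_tour[OF assms] by (simp add: strong_tour_def)
  have ge: "j - i \<le> rdist ?E i j" if "i \<in> {1..k}" "j \<in> {1..k}" for i j
    using backward_rdist_ge[OF assms that] by (auto split: if_splits)
  have "(\<Sum>x = 1..k. k - x) \<le> (\<Sum>x = 1..k. rdist ?E x k)"
    using assms by (intro sum_mono ge) auto
  with strong_on_in_sum_le[OF S, of k] sum_atLeastAtMost_diff[of k] assms
  show "2 * (\<Sum>x = 1..k. rdist ?E x k) + k = k * k" by simp
  have "(\<Sum>x = 1..k. k - x) = (\<Sum>y = 1..k. y - 1)"
    using sum.atLeastAtMost_rev[of "\<lambda>x. k - x" 1 k] by (auto intro: sum.cong)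
  also have "\<dots> \<le> (\<Sum>y = 1..k. rdist ?E 1 y)"
    using assms by (intro sum_mono ge) auto
  finally show "2 * (\<Sum>y = 1..k. rdist ?E 1 y) + k = k * k"
    using strong_on_out_sum_le[OF S, of 1] sum_atLeastAtMost_diff[of k] assms by simp
  show "rdist ?E 1 k + 1 = k"
    using strong_on_rdist_less[OF S, of 1 k] ge[of 1 k] assms by simp
qed

section \<open>Distances in a bag\<close>

definition bag_verts :: "'a set \<Rightarrow> nat \<Rightarrow> ('a + nat) set" where
  "bag_verts V m = Inl ` V \<union> Inr ` {1..m}"

definition bag_arcs :: "('a \<times> 'a) set \<Rightarrow> nat \<Rightarrow> 'a \<Rightarrow> 'a \<Rightarrow> (('a + nat) \<times> ('a + nat)) set" where
  "bag_arcs E m u w = map_prod Inl Inl ` E \<union> {(Inl u, Inr 1)}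
     \<union> {(Inr i, Inr (i + 1)) | i. 1 \<le> i \<and> i < m} \<union> {(Inr m, Inl w)}"

lemma bag_sel:
  "pverts (bag n T k a) = bag_verts (pverts T) (n - k)"
  "parcs (bag n T k a) = bag_arcs (parcs T) (n - k) (fst a) (snd a)"
  by (simp_all add: bag_def bag_verts_def bag_arcs_def)

lemma sum_bag_verts:
  assumes "finite V"
  shows "(\<Sum>z\<in>bag_verts V m. g z) = (\<Sum>x\<in>V. g (Inl x)) + (\<Sum>i = 1..m. g (Inr i))"
  unfolding bag_verts_def using assms
  by (subst sum.union_disjoint) (auto simp: sum.reindex)

lemma total_dist_bag_verts:
  assumes "finite V"
  shows "total_dist (bag_verts V m) H =
    (\<Sum>x\<in>V. \<Sum>y\<in>V. rdist H (Inl x) (Inl y)) + (\<Sum>x\<in>V. \<Sum>i = 1..m. rdist H (Inl x) (Inr i)) +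
    (\<Sum>i = 1..m. \<Sum>y\<in>V. rdist H (Inr i) (Inl y)) + (\<Sum>i = 1..m. \<Sum>j = 1..m. rdist H (Inr i) (Inr j))"
  unfolding total_dist_def using assms by (simp add: sum_bag_verts sum.distrib)

locale bag_graph =
  fixes V :: "'a set" and E :: "('a \<times> 'a) set" and u w :: 'a and m :: nat
  assumes strong: "strong_on V E" and arc: "(u, w) \<in> E" and m_pos: "1 \<le> m"
begin

abbreviation "H \<equiv> bag_arcs E m u w"

lemma fin: "finite V" and sub: "E \<subseteq> V \<times> V"
  and conn: "x \<in> V \<Longrightarrow> y \<in> V \<Longrightarrow> (x, y) \<in> E\<^sup>*"
  and uV: "u \<in> V" and wV: "w \<in> V"
  using strong arc by (auto simp: strong_on_def)

lemma bag_arcs_cases: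
  assumes "(a, b) \<in> H"
  obtains x y where "a = Inl x" "b = Inl y" "(x, y) \<in> E" "x \<in> V" "y \<in> V"
  | "a = Inl u" "b = Inr 1"
  | i where "a = Inr i" "b = Inr (i + 1)" "1 \<le> i" "i < m"
  | "a = Inr m" "b = Inl w"
  using assms sub unfolding bag_arcs_def by fastforce

lemma bag_arcsI:
  "(x, y) \<in> E \<Longrightarrow> (Inl x, Inl y) \<in> H" "(Inl u, Inr 1) \<in> H" "(Inl u, Inr (Suc 0)) \<in> H"
  "1 \<le> i \<Longrightarrow> i < m \<Longrightarrow> (Inr i, Inr (Suc i)) \<in> H" "(Inr m, Inl w) \<in> H"
  unfolding bag_arcs_def by auto

lemma relpow_Inl: "(x, y) \<in> E ^^ n \<Longrightarrow> (Inl x, Inl y) \<in> H ^^ n"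
  by (rule relpow_map[where E = E]) (rule bag_arcsI)

lemma relpow_Inr:
  assumes "1 \<le> i" "i \<le> j" "j \<le> m"
  shows "(Inr i, Inr j) \<in> H ^^ (j - i)"
proof -
  have "(Inr i, Inr (i + (j - i))) \<in> H ^^ (j - i)"
    by (rule relpow_chain) (use assms in \<open>auto intro: bag_arcsI\<close>)
  with assms(2) show ?thesis by simp
qed

lemma relpow_tail:
  assumes "1 \<le> i" "i \<le> m"
  shows "(Inl u, Inr i) \<in> H ^^ i"
  using relpow_Suc_I2[OF bag_arcsI(2) relpow_Inr[of 1 i]] assms by simp

lemma relpow_head:
  assumes "1 \<le> i" "i \<le> m"
  shows "(Inr i, Inl w) \<in> H ^^ (m + 1 - i)"
  using relpow_Suc_I[OF relpow_Inr[of i m] bag_arcsI(5)] assms by (simp add: Suc_diff_le)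

text \<open>The claimed distances from a vertex of \<open>T\<close>, serving as their own potential:
  the new path can be entered only at \<open>u\<close>.\<close>

fun dist_Inl :: "'a \<Rightarrow> 'a + nat \<Rightarrow> int" where
  "dist_Inl x (Inl y) = int (rdist E x y)"
| "dist_Inl x (Inr i) = int (rdist E x u) + int i"

lemma potential_from_Inl:
  assumes x: "x \<in> V" and ab: "(a, b) \<in> H"
  shows "dist_Inl x b \<le> dist_Inl x a + 1"
  using ab
proof (cases rule: bag_arcs_cases)
  case (1 y z)
  with rdist_step[of x y E z] conn[OF x] show ?thesis by simp
next
  \<comment> \<open>The arrow from \<open>u\<close> to \<open>w\<close> is kept, so arriving at
    \<open>w\<close> along the new path is never a shortcut.\<close>
  case 4
  with rdist_step[OF conn[OF x uV] arc] show ?thesis by simp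
qed auto

lemma rdist_Inl_Inl:
  assumes "x \<in> V" "y \<in> V"
  shows "rdist H (Inl x) (Inl y) = rdist E x y"
  using relpow_Inl[OF rdist_relpow[OF conn[OF assms]]]
  by (rule rdist_eqI[where f = "dist_Inl x"]) (auto intro: potential_from_Inl[OF assms(1)])

lemma rdist_Inl_Inr:
  assumes "x \<in> V" "i \<in> {1..m}"
  shows "rdist H (Inl x) (Inr i) = rdist E x u + i"
proof -
  have "(Inl x, Inr i) \<in> H ^^ (rdist E x u + i)"
    using relpow_Inl[OF rdist_relpow[OF conn[OF assms(1) uV]]] relpow_tail[of i] assms(2)
    by (auto intro: relpow_trans)
  then show ?thesis
    by (rule rdist_eqI[where f = "dist_Inl x"]) (auto intro: potential_from_Inl[OF assms(1)])
qed

text \<open>The new path is left only towards \<open>w\<close>. A new vertex behind position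
  \<open>i\<close> is therefore reached by going on to \<open>w\<close>, through \<open>T\<close> to
  \<open>u\<close>, and along the path again.\<close>

fun dist_Inr :: "nat \<Rightarrow> 'a + nat \<Rightarrow> int" where
  "dist_Inr i (Inl y) = int m + 1 - int i + int (rdist E w y)"
| "dist_Inr i (Inr j) =
    (if i \<le> j then int j - int i else int m + 1 - int i + int (rdist E w u) + int j)"

lemma potential_from_Inr:
  assumes i: "i \<in> {1..m}" and ab: "(a, b) \<in> H"
  shows "dist_Inr i b \<le> dist_Inr i a + 1"
  using ab
proof (cases rule: bag_arcs_cases)
  case (1 y z)
  with rdist_step[of w y E z] conn[OF wV] show ?thesis by simp
qed (use i in auto)

lemma rdist_Inr_Inl:
  assumes "i \<in> {1..m}" "y \<in> V"
  shows "rdist H (Inr i) (Inl y) = (m + 1 - i) + rdist E w y"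
proof -
  have "(Inr i, Inl y) \<in> H ^^ ((m + 1 - i) + rdist E w y)"
    using relpow_trans[OF relpow_head relpow_Inl[OF rdist_relpow[OF conn[OF wV assms(2)]]]] assms(1)
    by simp
  then show ?thesis
    by (rule rdist_eqI[where f = "dist_Inr i"])
      (use assms in \<open>auto intro: potential_from_Inr[OF assms(1)]\<close>)
qed

lemma rdist_Inr_Inr:
  assumes "i \<in> {1..m}" "j \<in> {1..m}"
  shows "rdist H (Inr i) (Inr j) = (if i \<le> j then j - i else (m + 1 - i) + rdist E w u + j)"
proof -
  have "(Inr i, Inr j) \<in> H ^^ ((m + 1 - i) + rdist E w u + j)"
    using relpow_trans[OF relpow_trans[OF relpow_head relpow_Inl[OF rdist_relpow[OF conn[OF wV uV]]]]
        relpow_tail, of i j] assms by simp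
  then have "(Inr i, Inr j) \<in> H ^^ (if i \<le> j then j - i else (m + 1 - i) + rdist E w u + j)"
    using relpow_Inr[of i j] assms by auto
  then show ?thesis
    by (rule rdist_eqI[where f = "dist_Inr i"])
      (use assms in \<open>auto intro: potential_from_Inr[OF assms(1)]\<close>)
qed

lemma strong_on_bag: "strong_on (bag_verts V m) H"
proof -
  have head: "(Inr i, Inl w) \<in> H\<^sup>*" and tail: "(Inl u, Inr i) \<in> H\<^sup>*" if "i \<in> {1..m}" for i
    using relpow_head[of i] relpow_tail[of i] that by (auto intro: relpow_imp_rtrancl)
  have Inl: "(Inl x, Inl y) \<in> H\<^sup>*" if "x \<in> V" "y \<in> V" for x y
    using relpow_Inl[OF rdist_relpow[OF conn[OF that]]] by (rule relpow_imp_rtrancl)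
  have "\<forall>a\<in>bag_verts V m. \<forall>b\<in>bag_verts V m. (a, b) \<in> H\<^sup>*"
  proof (rule strong_hub[of _ "Inl u"])
    fix z assume "z \<in> bag_verts V m"
    then consider x where "z = Inl x" "x \<in> V" | i where "z = Inr i" "i \<in> {1..m}"
      by (auto simp: bag_verts_def)
    then show "(Inl u, z) \<in> H\<^sup>* \<and> (z, Inl u) \<in> H\<^sup>*"
    proof cases
      case 1
      then show ?thesis using Inl uV by blast
    next
      case 2
      then show ?thesis using head[of i] tail[of i] Inl[OF wV uV] by auto
    qed
  qed
  moreover have "H \<subseteq> bag_verts V m \<times> bag_verts V m"
    using sub uV wV m_pos by (auto simp: bag_arcs_def bag_verts_def)
  moreover have "finite (bag_verts V m)" using fin by (simp add: bag_verts_def)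
  ultimately show ?thesis unfolding strong_on_def by blast
qed

text \<open>For distinct new vertices, going from one to the other and back runs once around the
  closed walk made of the path and a shortest way from \<open>w\<close> to \<open>u\<close>. Adding
  the transposed sum thus makes all off-diagonal terms equal.\<close>

lemma sum_Inr_Inr:
  "2 * (\<Sum>i = 1..m. \<Sum>j = 1..m. rdist H (Inr i) (Inr j)) = m * (m - 1) * (m + 1 + rdist E w u)"
proof -
  define c where "c i j = rdist H (Inr i) (Inr j)" for i j
  have "2 * (\<Sum>i = 1..m. \<Sum>j = 1..m. c i j) =
      (\<Sum>i = 1..m. \<Sum>j = 1..m. c i j) + (\<Sum>i = 1..m. \<Sum>j = 1..m. c j i)"
    using sum.swap[of c "{1..m}" "{1..m}"] by simp
  also have "\<dots> = (\<Sum>i = 1..m. \<Sum>j = 1..m. c i j + c j i)"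
    by (simp add: sum.distrib)
  also have "\<dots> = (\<Sum>i = 1..m. \<Sum>j\<in>{1..m} - {i}. m + 1 + rdist E w u)"
  proof (rule sum.cong[OF refl])
    fix i assume i: "i \<in> {1..m}"
    have "(\<Sum>j = 1..m. c i j + c j i) = (c i i + c i i) + (\<Sum>j\<in>{1..m} - {i}. c i j + c j i)"
      using i by (intro sum.remove) auto
    also have "c i i = 0" by (simp add: c_def)
    also have "(\<Sum>j\<in>{1..m} - {i}. c i j + c j i) = (\<Sum>j\<in>{1..m} - {i}. m + 1 + rdist E w u)"
      using i by (intro sum.cong) (auto simp: c_def rdist_Inr_Inr)
    finally show "(\<Sum>j = 1..m. c i j + c j i) = (\<Sum>j\<in>{1..m} - {i}. m + 1 + rdist E w u)" by simp
  qed
  also have "\<dots> = (\<Sum>i = 1..m. (m - 1) * (m + 1 + rdist E w u))"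
    by (intro sum.cong) auto
  also have "\<dots> = m * ((m - 1) * (m + 1 + rdist E w u))"
    by (simp only: sum_constant card_atLeastAtMost diff_Suc_1 of_nat_id)
  finally show ?thesis by (simp only: c_def mult.assoc)
qed

lemma sum_atLeastAtMost_1: "2 * (\<Sum>i = 1..m. i) = m * (m + 1)"
  using gauss_sum_from_Suc_0[of m, where 'a = nat] by (simp flip: One_nat_def)

lemma total_dist_bag:
  "2 * total_dist (bag_verts V m) H =
    2 * total_dist V E + 2 * m * ((\<Sum>x\<in>V. rdist E x u) + (\<Sum>y\<in>V. rdist E w y)) +
    2 * card V * m * (m + 1) + m * (m - 1) * (m + 1 + rdist E w u)"
proof -
  have "(\<Sum>x\<in>V. \<Sum>i = 1..m. rdist H (Inl x) (Inr i)) = (\<Sum>x\<in>V. \<Sum>i = 1..m. rdist E x u + i)"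
    by (intro sum.cong refl rdist_Inl_Inr)
  also have "\<dots> = m * (\<Sum>x\<in>V. rdist E x u) + card V * (\<Sum>i = 1..m. i)"
    by (simp add: sum.distrib sum_distrib_left)
  finally have 1: "(\<Sum>x\<in>V. \<Sum>i = 1..m. rdist H (Inl x) (Inr i)) =
    m * (\<Sum>x\<in>V. rdist E x u) + card V * (\<Sum>i = 1..m. i)" .
  have "(\<Sum>i = 1..m. \<Sum>y\<in>V. rdist H (Inr i) (Inl y)) =
      (\<Sum>i = 1..m. \<Sum>y\<in>V. (m + 1 - i) + rdist E w y)"
    by (intro sum.cong refl rdist_Inr_Inl)
  also have "\<dots> = card V * (\<Sum>i = 1..m. m + 1 - i) + m * (\<Sum>y\<in>V. rdist E w y)"
    by (simp only: sum.distrib) (simp flip: sum_distrib_left)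
  also have "(\<Sum>i = 1..m. m + 1 - i) = (\<Sum>i = 1..m. i)"
    using sum.atLeastAtMost_rev[of "\<lambda>i. i" 1 m] by simp
  finally have 2: "(\<Sum>i = 1..m. \<Sum>y\<in>V. rdist H (Inr i) (Inl y)) =
    card V * (\<Sum>i = 1..m. i) + m * (\<Sum>y\<in>V. rdist E w y)" .
  have 0: "(\<Sum>x\<in>V. \<Sum>y\<in>V. rdist H (Inl x) (Inl y)) = total_dist V E"
    unfolding total_dist_def by (intro sum.cong refl rdist_Inl_Inl)
  have "2 * total_dist (bag_verts V m) H = 2 * total_dist V E +
    2 * m * ((\<Sum>x\<in>V. rdist E x u) + (\<Sum>y\<in>V. rdist E w y)) + 2 * (card V * (2 * (\<Sum>i = 1..m. i))) +
    2 * (\<Sum>i = 1..m. \<Sum>j = 1..m. rdist H (Inr i) (Inr j))"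
    unfolding total_dist_bag_verts[OF fin] 0 1 2 by (simp add: algebra_simps)
  then show ?thesis
    unfolding sum_Inr_Inr sum_atLeastAtMost_1 by (simp add: algebra_simps)
qed

end

section \<open>The symmetrised bag\<close>

text \<open>Distances in the symmetrised bag from a vertex of \<open>T\<close> other than
  \<open>u\<close> and \<open>w\<close> to all new vertices.\<close>

definition path_ends_sum :: "nat \<Rightarrow> nat" where
  "path_ends_sum m = (\<Sum>i = 1..m. min (i + 1) (m + 2 - i))"

text \<open>Distances from one vertex of an undirected cycle of length \<open>m + 2\<close> to all
  the others.\<close>

definition cycle_point_sum :: "nat \<Rightarrow> nat" where
  "cycle_point_sum m = (\<Sum>t = 1..m + 1. min t (m + 2 - t))"

section \<open>Closed forms by the parity of m\<close>

lemma sum_first_last: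
  fixes g :: "nat \<Rightarrow> nat"
  shows "(\<Sum>i = 1..n + 2. g i) = g 1 + (\<Sum>i = 1..n. g (i + 1)) + g (n + 2)"
proof -
  have "(\<Sum>i = 1..n + 2. g i) = (\<Sum>i = 1..Suc n. g i) + g (n + 2)" by simp
  also have "(\<Sum>i = 1..Suc n. g i) = g 1 + (\<Sum>i = Suc 1..Suc n. g i)"
    by (rule sum.atLeast_Suc_atMost) simp
  also have "(\<Sum>i = Suc 1..Suc n. g i) = (\<Sum>i = 1..n. g (i + 1))"
    using sum.shift_bounds_cl_Suc_ivl[of g 1 n] by simp
  finally show ?thesis .
qed

text \<open>Steps of two preserve the parity. One new vertex at each end of the path puts every old
  one a step further from both ends, so each minimum grows by 1; the two new terms are 2
  each.\<close>

lemma path_ends_sum_step: "path_ends_sum (m + 2) = path_ends_sum m + m + 4"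
proof -
  have "path_ends_sum (m + 2) = (\<Sum>i = 1..m. min (i + 1 + 1) (m + 2 + 2 - (i + 1))) + 4"
    unfolding path_ends_sum_def sum_first_last by simp
  also have "(\<Sum>i = 1..m. min (i + 1 + 1) (m + 2 + 2 - (i + 1))) = (\<Sum>i = 1..m. min (i + 1) (m + 2 - i) + 1)"
    by (intro sum.cong) auto
  also have "\<dots> = path_ends_sum m + m"
    unfolding path_ends_sum_def sum.distrib by simp
  finally show ?thesis by simp
qed

lemma cycle_point_sum_step: "cycle_point_sum (m + 2) = cycle_point_sum m + m + 3"
proof -
  have eq: "m + 2 + 1 = (m + 1) + 2" by simp
  have "cycle_point_sum (m + 2) = (\<Sum>t = 1..m + 1. min (t + 1) (m + 2 + 2 - (t + 1))) + 2"
    unfolding cycle_point_sum_def eq sum_first_last by simp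
  also have "(\<Sum>t = 1..m + 1. min (t + 1) (m + 2 + 2 - (t + 1))) = (\<Sum>t = 1..m + 1. min t (m + 2 - t) + 1)"
    by (intro sum.cong) auto
  also have "\<dots> = cycle_point_sum m + (m + 1)"
    unfolding cycle_point_sum_def sum.distrib by simp
  finally show ?thesis by simp
qed

lemma path_ends_sum_closed:
  "path_ends_sum (2 * q) = q * q + 3 * q" "path_ends_sum (2 * q + 1) = q * q + 4 * q + 2"
proof (induction q)
  case (Suc q)
  { case 1 from path_ends_sum_step[of "2 * q"] Suc(1) show ?case by simp }
  { case 2 from path_ends_sum_step[of "2 * q + 1"] Suc(2) show ?case by simp }
qed (simp_all add: path_ends_sum_def)

lemma cycle_point_sum_closed:
  "cycle_point_sum (2 * q) = (q + 1) * (q + 1)" "cycle_point_sum (2 * q + 1) = (q + 1) * (q + 2)"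
proof (induction q)
  case 0
  { case 1 show ?case by (simp add: cycle_point_sum_def) }
  { case 2 show ?case by (simp add: cycle_point_sum_def) }
next
  case (Suc q)
  { case 1 from cycle_point_sum_step[of "2 * q"] Suc(1) show ?case by simp }
  { case 2 from cycle_point_sum_step[of "2 * q + 1"] Suc(2) show ?case by simp }
qed

text \<open>The distance of two positions on an undirected cycle of length \<open>N\<close>; the
  case split keeps truncated subtraction exact.\<close>

definition cycle_dist :: "nat \<Rightarrow> nat \<Rightarrow> nat \<Rightarrow> nat" where
  "cycle_dist N i j = (if i \<le> j then min (j - i) (N - (j - i)) else min (i - j) (N - (i - j)))"

text \<open>The path together with both ends of the arc forms a cycle of length m + 2, and every
  vertex of a cycle has the same sum of distances.\<close>

lemma cycle_row_sum:
  assumes "i \<in> {1..m}"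
  shows "(\<Sum>j = 1..m. cycle_dist (m + 2) i j) + min i (m + 2 - i) + min (i + 1) (m + 1 - i) =
    cycle_point_sum m"
proof -
  define h where "h t = min t (m + 2 - t)" for t
  \<comment> \<open>Walking round the cycle from position \<open>i\<close> towards \<open>u\<close>,
    position \<open>j < i\<close> comes after \<open>i - j\<close> steps, \<open>u\<close> after
    \<open>i\<close>, \<open>w\<close> after \<open>i + 1\<close>, and position \<open>j > i\<close>
    after \<open>m + 2 + i - j\<close>.\<close>
  have un: "{1..m} = {1..<i} \<union> {i} \<union> {i<..m}" "{1..m + 1} = {1..<i} \<union> {i, i + 1} \<union> {i + 2..m + 1}"
    using assms by auto
  have left: "(\<Sum>j\<in>{1..<i}. cycle_dist (m + 2) i j) = (\<Sum>t\<in>{1..<i}. h t)"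
    by (rule sum.reindex_bij_witness[of _ "\<lambda>t. i - t" "\<lambda>j. i - j"])
      (auto simp: cycle_dist_def h_def)
  have right: "(\<Sum>j\<in>{i<..m}. cycle_dist (m + 2) i j) = (\<Sum>t\<in>{i + 2..m + 1}. h t)"
    by (rule sum.reindex_bij_witness[of _ "\<lambda>t. m + 2 + i - t" "\<lambda>j. m + 2 + i - j"])
      (auto simp: cycle_dist_def h_def min_def)
  have "(\<Sum>j = 1..m. cycle_dist (m + 2) i j) =
      (\<Sum>j\<in>{1..<i}. cycle_dist (m + 2) i j) + cycle_dist (m + 2) i i + (\<Sum>j\<in>{i<..m}. cycle_dist (m + 2) i j)"
    unfolding un(1) by (subst sum.union_disjoint; auto)+
  also have "cycle_dist (m + 2) i i = 0" by (simp add: cycle_dist_def)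
  also have "(\<Sum>t = 1..m + 1. h t) = (\<Sum>t\<in>{1..<i}. h t) + (h i + h (i + 1)) + (\<Sum>t\<in>{i + 2..m + 1}. h t)"
    unfolding un(2) by (subst sum.union_disjoint; auto)+
  ultimately show ?thesis
    using left right by (simp add: cycle_point_sum_def h_def)
qed

text \<open>These are the distances from \<open>u\<close> to the new vertices; the missing 1 is the
  distance to \<open>w\<close>, the term \<open>t = m + 1\<close> of the cycle sum.\<close>

lemma min_sum_eq: "(\<Sum>i = 1..m. min i (m + 2 - i)) + 1 = cycle_point_sum m"
  by (simp add: cycle_point_sum_def)

lemma min_sum_eq': "(\<Sum>i = 1..m. min (i + 1) (m + 1 - i)) + 1 = cycle_point_sum m"
proof -
  have "(\<Sum>i = 1..m. min (i + 1) (m + 1 - i)) = (\<Sum>i = 1..m. min i (m + 2 - i))"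
    by (rule sum.reindex_bij_witness[of _ "\<lambda>i. m + 1 - i" "\<lambda>i. m + 1 - i"]) (auto simp: min_def)
  with min_sum_eq show ?thesis by simp
qed

lemma cycle_dist_sum:
  "(\<Sum>i = 1..m. \<Sum>j = 1..m. cycle_dist (m + 2) i j) + 2 * cycle_point_sum m = m * cycle_point_sum m + 2"
proof -
  have "(\<Sum>i = 1..m. \<Sum>j = 1..m. cycle_dist (m + 2) i j) + (\<Sum>i = 1..m. min i (m + 2 - i)) +
      (\<Sum>i = 1..m. min (i + 1) (m + 1 - i)) = (\<Sum>i = 1..m. cycle_point_sum m)"
    unfolding sum.distrib[symmetric] by (intro sum.cong refl cycle_row_sum)
  with min_sum_eq[of m] min_sum_eq'[of m] show ?thesis by simp
qed

lemma rdist_eq_minI: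
  fixes f :: "'a \<Rightarrow> int"
  assumes "(x, y) \<in> E ^^ p" "(x, y) \<in> E ^^ q" "\<And>a b. (a, b) \<in> E \<Longrightarrow> f b \<le> f a + 1"
    "int (min p q) \<le> f y - f x"
  shows "rdist E x y = min p q"
  by (rule rdist_eqI[OF _ assms(3,4)]) (use assms(1,2) in \<open>simp_all add: min_def\<close>)

section \<open>Distances after symmetrising the bag of a tournament\<close>

locale tour_bag = bag_graph V E u w m
  for V :: "'a set" and E and u w :: 'a and m +
  assumes tour: "strong_tour V E"
begin

abbreviation "F \<equiv> H \<union> H\<inverse>"

lemma uw: "u \<noteq> w"
  using tour arc by (auto simp: strong_tour_def)

lemma sym_relpow: "(x, y) \<in> H ^^ n \<Longrightarrow> (x, y) \<in> F ^^ n"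
  by (rule relpow_map[where h = "\<lambda>z. z" and E = H]) auto

lemma sym_relpow_converse: "(x, y) \<in> F ^^ n \<Longrightarrow> (y, x) \<in> F ^^ n"
  using relpow_converse[of n F] by (auto simp: converse_Un Un_commute)

lemma rdist_sym: "rdist F x y = rdist F y x"
  using rdist_converse[of F x y] by (simp add: converse_Un Un_commute)

lemma sym_arc:
  assumes "x \<in> V" "y \<in> V" "x \<noteq> y"
  shows "(Inl x, Inl y) \<in> F"
  using tour assms bag_arcsI(1) unfolding strong_tour_def by blast

lemma rdist_sym_Inl_Inl:
  assumes "x \<in> V" "y \<in> V"
  shows "rdist F (Inl x) (Inl y) = of_bool (x \<noteq> y)"
  using rdist_arc[OF sym_arc[OF assms]] by (cases "x = y") auto

lemma sym_potentialI:
  fixes f :: "'a + nat \<Rightarrow> int"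
  assumes "\<And>x y. x \<in> V \<Longrightarrow> y \<in> V \<Longrightarrow> \<bar>f (Inl x) - f (Inl y)\<bar> \<le> 1"
    "\<bar>f (Inl u) - f (Inr 1)\<bar> \<le> 1" "\<bar>f (Inr m) - f (Inl w)\<bar> \<le> 1"
    "\<And>i. 1 \<le> i \<Longrightarrow> i < m \<Longrightarrow> \<bar>f (Inr i) - f (Inr (i + 1))\<bar> \<le> 1"
    and ab: "(a, b) \<in> F"
  shows "f b \<le> f a + 1"
proof -
  have "\<bar>f c - f d\<bar> \<le> 1" if "(c, d) \<in> H" for c d
    using that by (cases rule: bag_arcs_cases) (use assms in auto)
  from this[of a b] this[of b a] ab show ?thesis by auto
qed

text \<open>The path may now be entered from either end, and \<open>u\<close> and \<open>w\<close>
  are at most one step away from \<open>x\<close>; the \<open>of_bool\<close> terms count that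
  step.\<close>

lemma rdist_sym_Inl_Inr:
  assumes x: "x \<in> V" and i: "i \<in> {1..m}"
  shows "rdist F (Inl x) (Inr i) = min (of_bool (x \<noteq> u) + i) (of_bool (x \<noteq> w) + (m + 1 - i))"
proof -
  have to: "(Inl x, Inl y) \<in> F ^^ of_bool (x \<noteq> y)" if "y \<in> V" for y
    using sym_arc[OF x that] by (cases "x = y") auto
  define f :: "'a + nat \<Rightarrow> int" where
    "f = case_sum (\<lambda>y. of_bool (x \<noteq> y))
      (\<lambda>j. min (of_bool (x \<noteq> u) + int j) (of_bool (x \<noteq> w) + (int m + 1 - int j)))"
  show ?thesis
  proof (rule rdist_eq_minI[where f = f])
    show "(Inl x, Inr i) \<in> F ^^ (of_bool (x \<noteq> u) + i)"
      using relpow_trans[OF to[OF uV] sym_relpow[OF relpow_tail]] i by simp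
    show "(Inl x, Inr i) \<in> F ^^ (of_bool (x \<noteq> w) + (m + 1 - i))"
      using relpow_trans[OF to[OF wV] sym_relpow_converse[OF sym_relpow[OF relpow_head]]] i by simp
    show "f b \<le> f a + 1" if "(a, b) \<in> F" for a b
      by (rule sym_potentialI[OF _ _ _ _ that]) (use m_pos in \<open>auto simp: f_def min_def\<close>)
    show "int (min (of_bool (x \<noteq> u) + i) (of_bool (x \<noteq> w) + (m + 1 - i))) \<le> f (Inr i) - f (Inl x)"
      using i by (auto simp: f_def min_def)
  qed
qed

lemma rdist_sym_Inr_Inr:
  assumes i: "i \<in> {1..m}" and j: "j \<in> {1..m}"
  shows "rdist F (Inr i) (Inr j) = cycle_dist (m + 2) i j"
proof -
  have le: "rdist F (Inr i) (Inr j) = cycle_dist (m + 2) i j"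
    if i: "i \<in> {1..m}" and j: "j \<in> {1..m}" and "i \<le> j" for i j
  proof -
    \<comment> \<open>The distances from position \<open>i\<close>: new vertices and
      \<open>u\<close>, \<open>w\<close> lie on the cycle of length \<open>m + 2\<close>, and every
      other vertex of \<open>T\<close> is one step beyond the nearer of \<open>u\<close> and
      \<open>w\<close>.\<close>
    define f :: "'a + nat \<Rightarrow> int" where
      "f = case_sum (\<lambda>y. if y = u then min (int i) (int m + 2 - int i)
          else if y = w then min (int i + 1) (int m + 1 - int i)
          else min (int i + 1) (int m + 2 - int i))
        (\<lambda>l. min \<bar>int l - int i\<bar> (int m + 2 - \<bar>int l - int i\<bar>))"
    have "rdist F (Inr i) (Inr j) = min (j - i) ((m + 1 - j) + 1 + i)"
    proof (rule rdist_eq_minI[where f = f])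
      show "(Inr i, Inr j) \<in> F ^^ (j - i)"
        using sym_relpow[OF relpow_Inr] that by simp
      have "(Inr j, Inr i) \<in> F ^^ ((m + 1 - j) + 1 + i)"
        using relpow_trans[OF relpow_trans[OF sym_relpow[OF relpow_head]]
            sym_relpow[OF relpow_tail], of j 1 i] sym_arc[OF wV uV] uw that by simp
      then show "(Inr i, Inr j) \<in> F ^^ ((m + 1 - j) + 1 + i)"
        by (rule sym_relpow_converse)
      show "f b \<le> f a + 1" if "(a, b) \<in> F" for a b
        by (rule sym_potentialI[OF _ _ _ _ that]) (use uw m_pos i in \<open>auto simp: f_def min_def abs_if\<close>)
      show "int (min (j - i) ((m + 1 - j) + 1 + i)) \<le> f (Inr j) - f (Inr i)"
        using that by (auto simp: f_def min_def)
    qed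
    also have "\<dots> = cycle_dist (m + 2) i j"
      using that by (auto simp: cycle_dist_def min_def)
    finally show ?thesis .
  qed
  have "cycle_dist (m + 2) i j = cycle_dist (m + 2) j i"
    by (simp add: cycle_dist_def)
  with le[OF i j] le[OF j i] rdist_sym[of "Inr i" "Inr j"] show ?thesis
    by (cases "i \<le> j") simp_all
qed

lemma strong_on_sym: "strong_on (bag_verts V m) F"
  using strong_on_bag rtrancl_mono[of H F] unfolding strong_on_def by blast

text \<open>The terms on the right are the complete graph on \<open>V\<close>, the pairs of a new
  vertex with a vertex of \<open>V\<close> off the cycle, and the cycle of length
  \<open>m + 2\<close>. The two ordered pairs of \<open>u\<close> and \<open>w\<close> belong to
  both the complete graph and the cycle, hence the 2 on the left.\<close>

lemma total_dist_sym_bag: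
  "total_dist (bag_verts V m) F + 2 =
    card V * (card V - 1) + 2 * (card V - 2) * path_ends_sum m + (m + 2) * cycle_point_sum m"
proof -
  define row where "row x = (\<Sum>i = 1..m. rdist F (Inl x) (Inr i))" for x
  have rest: "row x = path_ends_sum m" if "x \<in> V - {u, w}" for x
    unfolding row_def path_ends_sum_def using that
    by (intro sum.cong) (auto simp: rdist_sym_Inl_Inr)
  have "row u = (\<Sum>i = 1..m. min i (m + 2 - i))"
    unfolding row_def using uw uV by (intro sum.cong) (auto simp: rdist_sym_Inl_Inr)
  then have u: "row u + 1 = cycle_point_sum m" using min_sum_eq[of m] by simp
  have "row w = (\<Sum>i = 1..m. min (i + 1) (m + 1 - i))"
    unfolding row_def using uw wV by (intro sum.cong) (auto simp: rdist_sym_Inl_Inr)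
  then have w: "row w + 1 = cycle_point_sum m" using min_sum_eq'[of m] by simp
  have "(\<Sum>x\<in>V. row x) = row u + (\<Sum>x\<in>V - {u}. row x)"
    using fin uV by (rule sum.remove)
  also have "(\<Sum>x\<in>V - {u}. row x) = row w + (\<Sum>x\<in>V - {u} - {w}. row x)"
    using fin wV uw by (intro sum.remove) auto
  also have "(\<Sum>x\<in>V - {u} - {w}. row x) = (\<Sum>x\<in>V - {u} - {w}. path_ends_sum m)"
    by (intro sum.cong rest) auto
  also have "\<dots> = (card V - 2) * path_ends_sum m"
    using fin uV wV uw by (simp add: numeral_2_eq_2)
  finally have rows: "(\<Sum>x\<in>V. row x) + 2 = (card V - 2) * path_ends_sum m + 2 * cycle_point_sum m"
    using u w by simp
  have "(\<Sum>x\<in>V. \<Sum>y\<in>V. rdist F (Inl x) (Inl y)) = (\<Sum>x\<in>V. \<Sum>y\<in>V. of_bool (x \<noteq> y))"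
    by (intro sum.cong refl rdist_sym_Inl_Inl)
  also have "\<dots> = (\<Sum>x\<in>V. card V - 1)"
  proof (intro sum.cong refl)
    fix x assume x: "x \<in> V"
    have "(\<Sum>y\<in>V. of_bool (x \<noteq> y) :: nat) = of_bool (x \<noteq> x) + (\<Sum>y\<in>V - {x}. of_bool (x \<noteq> y))"
      using fin x by (rule sum.remove)
    also have "(\<Sum>y\<in>V - {x}. of_bool (x \<noteq> y) :: nat) = (\<Sum>y\<in>V - {x}. 1)"
      by (intro sum.cong) auto
    finally show "(\<Sum>y\<in>V. of_bool (x \<noteq> y)) = card V - 1" using x fin by simp
  qed
  finally have T: "(\<Sum>x\<in>V. \<Sum>y\<in>V. rdist F (Inl x) (Inl y)) = card V * (card V - 1)" by simp
  have "(\<Sum>i = 1..m. \<Sum>y\<in>V. rdist F (Inr i) (Inl y)) = (\<Sum>y\<in>V. row y)"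
    unfolding row_def by (subst sum.swap) (intro sum.cong refl rdist_sym)
  moreover have "(\<Sum>i = 1..m. \<Sum>j = 1..m. rdist F (Inr i) (Inr j)) =
      (\<Sum>i = 1..m. \<Sum>j = 1..m. cycle_dist (m + 2) i j)"
    by (intro sum.cong refl rdist_sym_Inr_Inr)
  ultimately have "total_dist (bag_verts V m) F = card V * (card V - 1) + 2 * (\<Sum>x\<in>V. row x) +
      (\<Sum>i = 1..m. \<Sum>j = 1..m. cycle_dist (m + 2) i j)"
    unfolding total_dist_bag_verts[OF fin] T by (simp add: row_def)
  with rows cycle_dist_sum[of m]
  show ?thesis unfolding distrib_right mult.assoc by linarith
qed

end

section \<open>The price of symmetrisation of a bag\<close>

context tour_bag
begin

text \<open>Adding arcs only shortens distances; this removes the absolute value from the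
  price.\<close>

lemma total_dist_sym_le: "total_dist (bag_verts V m) F \<le> total_dist (bag_verts V m) H"
  unfolding total_dist_def using strong_on_bag
  by (intro sum_mono rdist_antimono) (auto simp: strong_on_def)

end

definition sym_dist :: "nat \<Rightarrow> nat \<Rightarrow> int" where
  "sym_dist k m = int k * (int k - 1) + 2 * (int k - 2) * int (path_ends_sum m)
     + (int m + 2) * int (cycle_point_sum m) - 2"

lemma price_bag_eq:
  assumes "tournament T" "strongly_connected (with_proj T)" "card (pverts T) = k" "a \<in> parcs T"
    and "3 \<le> k" "k < n"
  defines "m \<equiv> n - k"
  shows "2 * price_of_symmetrisation (bag n T k a) =
    int (2 * total_dist (pverts T) (parcs T) +
      2 * m * ((\<Sum>x\<in>pverts T. rdist (parcs T) x (fst a)) + (\<Sum>y\<in>pverts T. rdist (parcs T) (snd a) y)) +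
      2 * k * m * (m + 1) + m * (m - 1) * (m + 1 + rdist (parcs T) (snd a) (fst a))) -
    2 * sym_dist k m"
proof -
  let ?V = "pverts T" and ?E = "parcs T" and ?G = "bag n T k a"
  have T: "strong_tour ?V ?E" using assms(1,2) by (rule tournament_strong_tour)
  interpret tour_bag ?V ?E "fst a" "snd a" m
    using T assms by unfold_locales (auto simp: strong_tour_def)
  have G: "transmission ?G = total_dist (bag_verts ?V m) H"
    using transmission_eq_total_dist[of ?G] strong_on_bag by (simp add: bag_sel m_def)
  have parcs: "parcs (mk_symmetric (with_proj ?G)) = F"
    by (auto simp: parcs_mk_symmetric bag_sel m_def)
  have S: "transmission (mk_symmetric (with_proj ?G)) = total_dist (bag_verts ?V m) F"
    using transmission_eq_total_dist[of "mk_symmetric (with_proj ?G)"] strong_on_sym parcs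
    by (simp add: bag_sel m_def)
  have price: "price_of_symmetrisation ?G = int (total_dist (bag_verts ?V m) H) - int (total_dist (bag_verts ?V m) F)"
    unfolding price_of_symmetrisation_def G S using total_dist_sym_le by simp
  have k: "int (card ?V - 1) = int k - 1" "int (card ?V - 2) = int k - 2"
    using assms(3,5) by simp_all
  have "int (total_dist (bag_verts ?V m) F + 2) = sym_dist k m + 2"
    unfolding total_dist_sym_bag sym_dist_def of_nat_add of_nat_mult of_nat_numeral k
    by (simp add: assms(3))
  then have F: "int (total_dist (bag_verts ?V m) F) = sym_dist k m" by simp
  have "2 * price_of_symmetrisation ?G = int (2 * total_dist (bag_verts ?V m) H) - 2 * sym_dist k m"
    unfolding price F by simp
  then show ?thesis unfolding total_dist_bag assms(3) .
qed

text \<open>Six times the upper bound on the price; the factor 6 clears the denominators of the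
  binomial coefficients.\<close>

definition bag_value :: "nat \<Rightarrow> nat \<Rightarrow> int" where
  "bag_value k m = int k * (int k + 1) * (int k + 2) - 6 + 6 * int m * (int k * int k - int k)
     + 6 * int k * int m * (int m + 1) + 3 * int m * (int m - 1) * (int m + int k) - 6 * sym_dist k m"

lemma price_bag_le:
  assumes "tournament T" "strongly_connected (with_proj T)" "card (pverts T) = k" "a \<in> parcs T"
    and "3 \<le> k" "k < n"
  shows "6 * price_of_symmetrisation (bag n T k a) \<le> bag_value k (n - k)"
proof -
  let ?V = "pverts T" and ?E = "parcs T"
  define m where "m = n - k"
  define s where "s = total_dist ?V ?E"
  define p where "p = (\<Sum>x\<in>?V. rdist ?E x (fst a))"
  define q where "q = (\<Sum>y\<in>?V. rdist ?E (snd a) y)"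
  define d where "d = rdist ?E (snd a) (fst a)"
  have T: "strong_tour ?V ?E" using assms(1,2) by (rule tournament_strong_tour)
  then have S: "strong_on ?V ?E" by (simp add: strong_tour_def)
  have uw: "fst a \<in> ?V" "snd a \<in> ?V" using S assms(4) by (auto simp: strong_on_def)
  have m1: "1 \<le> m" using assms(6) by (simp add: m_def)
  then have m2: "int (m - 1) = int m - 1" by simp
  have "6 * s + 6 \<le> k * (k + 1) * (k + 2)"
    using strong_tour_total_dist_le[OF T] assms(3,5) by (simp add: s_def)
  then have "int (6 * s + 6) \<le> int (k * (k + 1) * (k + 2))" by (simp only: of_nat_le_iff)
  then have 1: "6 * int s \<le> int k * (int k + 1) * (int k + 2) - 6" by (simp add: algebra_simps)
  have "int (2 * p + k) \<le> int (k * k)" "int (2 * q + k) \<le> int (k * k)"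
    using strong_on_in_sum_le[OF S uw(1)] strong_on_out_sum_le[OF S uw(2)] assms(3)
    by (simp_all only: of_nat_le_iff p_def q_def)
  then have "int p + int q \<le> int k * int k - int k" by simp
  then have 2: "6 * int m * (int p + int q) \<le> 6 * int m * (int k * int k - int k)"
    by (intro mult_left_mono) auto
  have "int d \<le> int k - 1"
    using strong_on_rdist_less[OF S uw(2,1)] assms(3) by (simp add: d_def)
  then have 3: "3 * int m * (int m - 1) * (int m + 1 + int d) \<le> 3 * int m * (int m - 1) * (int m + int k)"
    using m1 by (intro mult_left_mono) auto
  have "2 * price_of_symmetrisation (bag n T k a) =
    int (2 * s + 2 * m * (p + q) + 2 * k * m * (m + 1) + m * (m - 1) * (m + 1 + d)) - 2 * sym_dist k m"
    using price_bag_eq[OF assms] by (simp only: s_def p_def q_def d_def m_def)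
  also have "\<dots> = 2 * int s + 2 * int m * (int p + int q) + 2 * int k * int m * (int m + 1)
     + int m * (int m - 1) * (int m + 1 + int d) - 2 * sym_dist k m"
    by (simp only: of_nat_add of_nat_mult of_nat_numeral of_nat_1 m2)
  finally have "6 * price_of_symmetrisation (bag n T k a) = 6 * int s + 6 * int m * (int p + int q)
     + 6 * int k * int m * (int m + 1) + 3 * int m * (int m - 1) * (int m + 1 + int d) - 6 * sym_dist k m"
    by (simp add: algebra_simps)
  with 1 2 3 show ?thesis unfolding bag_value_def m_def by linarith
qed

lemma backward_tournament_tournament:
  assumes "3 \<le> k"
  shows "tournament (backward_tournament k)" "strongly_connected (with_proj (backward_tournament k))"
proof -
  let ?B = "backward_tournament k"
  have T: "strong_tour (pverts ?B) (parcs ?B)" using backward_strong_tour[OF assms] by simp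
  then have wf: "parcs ?B \<subseteq> pverts ?B \<times> pverts ?B"
    by (simp only: strong_tour_def strong_on_def)
  interpret pair_digraph ?B
  proof
    show "finite (parcs ?B)" using wf by (rule finite_subset) simp
    show "fst e \<noteq> snd e" if "e \<in> parcs ?B" for e
      using that T unfolding strong_tour_def by (metis prod.collapse)
  qed (use wf in auto)
  show "tournament ?B"
    using T pair_digraph_axioms unfolding tournament_def strong_tour_def by blast
  have "x \<rightarrow>\<^sup>*\<^bsub>with_proj ?B\<^esub> y" if xy: "x \<in> pverts ?B" "y \<in> pverts ?B" for x y
  proof -
    have "(x, y) \<in> (parcs ?B)\<^sup>*" using T xy unfolding strong_tour_def strong_on_def by blast
    from relpow_awalk[OF rdist_relpow[OF this] xy(1)] obtain p where "awalk x p y" by blast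
    then show ?thesis by (rule reachable_awalkI)
  qed
  then show "strongly_connected (with_proj ?B)"
    using assms unfolding strongly_connected_def by simp
qed

text \<open>All the estimates of \<open>price_bag_le\<close> are equalities for the arrow
  \<open>(k, 1)\<close>.\<close>

lemma price_backward_bag:
  assumes "3 \<le> k" "k < n"
  shows "6 * price_of_symmetrisation (backward_bag n k) = bag_value k (n - k)"
proof -
  let ?B = "backward_tournament k"
  define m where "m = n - k"
  define s where "s = total_dist {1..k} (parcs ?B)"
  define p where "p = (\<Sum>x = 1..k. rdist (parcs ?B) x k)"
  define q where "q = (\<Sum>y = 1..k. rdist (parcs ?B) 1 y)"
  define d where "d = rdist (parcs ?B) 1 k"
  have m2: "int (m - 1) = int m - 1" using assms(2) by (simp add: m_def)
  have "int (6 * s + 6) = int (k * (k + 1) * (k + 2))"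
    using backward_total_dist[OF assms(1)] by (simp only: s_def)
  then have 1: "6 * int s = int k * (int k + 1) * (int k + 2) - 6" by (simp add: algebra_simps)
  have "int (2 * p + k) = int (k * k)" "int (2 * q + k) = int (k * k)"
    using backward_extreme_dists[OF assms(1)] by (simp_all only: p_def q_def)
  then have 2: "int p + int q = int k * int k - int k" by simp
  have 3: "int m + 1 + int d = int m + int k"
    using backward_extreme_dists(3)[OF assms(1)] by (simp add: d_def)
  have "(k, 1) \<in> parcs ?B" using assms(1) by simp
  from price_bag_eq[OF backward_tournament_tournament[OF assms(1)] _ this assms]
  have "2 * price_of_symmetrisation (backward_bag n k) =
    int (2 * s + 2 * m * (p + q) + 2 * k * m * (m + 1) + m * (m - 1) * (m + 1 + d)) - 2 * sym_dist k m"
    by (simp only: s_def p_def q_def d_def m_def backward_bag_def fst_conv snd_conv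
        backward_tournament_sel(1) card_atLeastAtMost diff_Suc_1 One_nat_def simp_thms)
  also have "\<dots> = 2 * int s + 2 * int m * (int p + int q) + 2 * int k * int m * (int m + 1)
     + int m * (int m - 1) * (int m + 1 + int d) - 2 * sym_dist k m"
    by (simp only: of_nat_add of_nat_mult of_nat_numeral of_nat_1 m2)
  finally have "6 * price_of_symmetrisation (backward_bag n k) = 6 * int s + 6 * int m * (int p + int q)
     + 6 * int k * int m * (int m + 1) + 3 * int m * (int m - 1) * (int m + 1 + int d) - 6 * sym_dist k m"
    by (simp add: algebra_simps)
  then show ?thesis unfolding 1 2 3 unfolding bag_value_def m_def by simp
qed

section \<open>The optimal order of the tournament\<close>

text \<open>The order \<open>n\<close> is fixed, so raising \<open>k\<close> lowers the number of
  new vertices and flips its parity; this is why each difference mixes an even and an odd closed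
  form. The cubic terms cancel.\<close>

lemma bag_value_diff:
  "bag_value (k + 1) (2 * q) - bag_value k (2 * q + 1) =
    6 * int q * int q - 3 * int k * int k + 15 * int k - 18 * int q - 18"
  "bag_value (k + 1) (2 * q + 1) - bag_value k (2 * q + 2) =
    6 * int q * int q - 3 * int k * int k + 9 * int k - 6 * int q - 6"
proof -
  have e: "2 * q + 2 = 2 * (q + 1)" by simp
  show "bag_value (k + 1) (2 * q) - bag_value k (2 * q + 1) =
    6 * int q * int q - 3 * int k * int k + 15 * int k - 18 * int q - 18"
    unfolding bag_value_def sym_dist_def path_ends_sum_closed cycle_point_sum_closed
    by (simp add: algebra_simps)
  show "bag_value (k + 1) (2 * q + 1) - bag_value k (2 * q + 2) =
    6 * int q * int q - 3 * int k * int k + 9 * int k - 6 * int q - 6"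
    unfolding e bag_value_def sym_dist_def path_ends_sum_closed cycle_point_sum_closed
    by (simp add: algebra_simps)
qed

text \<open>The hypotheses on squares say k + 1 \<le> r_opt n and r_opt n \<le> k respectively, with the
  irrational square root squared away.\<close>

lemma bag_value_increasing:
  fixes k m n :: nat
  assumes n: "n = k + m + 1" and "11 \<le> n" "3 \<le> k"
    and le: "2 * (int k + int n - 7)\<^sup>2 \<le> (2 * int n - 11)\<^sup>2"
  shows "bag_value k (m + 1) < bag_value (k + 1) m"
proof (cases "even m")
  case True
  then obtain q where m: "m = 2 * q" by (auto elim: evenE)
  have le': "4 * int k * int k + 24 * int q \<le> 8 * int q * int q + 12 * int k + 9"
    using le unfolding n m by (simp add: power2_eq_square algebra_simps)
  have "0 < 6 * int q * int q - 3 * int k * int k + 15 * int k - 18 * int q - 18"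
  \<comment> \<open>Subtracting three quarters of \<open>le'\<close> cancels the quadratic terms and
    leaves at least 6 k - 99/4, which is positive from k = 5 on.\<close>
  proof (cases "5 \<le> k")
    case True
    with le' show ?thesis by linarith
  next
    case False
    with assms(3) consider "k = 3" | "k = 4" by linarith
    then show ?thesis
    proof cases
      case 1
      \<comment> \<open>Here \<open>11 \<le> n\<close> is essential: for q = 3, that is n = 10, the
        increment is 0 and the orders 3 and 4 give the same price.\<close>
      with n m assms(2) have "4 \<le> int q" by linarith
      then have "4 * int q \<le> int q * int q" by (intro mult_right_mono) auto
      with 1 \<open>4 \<le> int q\<close> show ?thesis by (simp add: mult.assoc)
    next
      case 2
      \<comment> \<open>The value q = 3 means n = 11, where k + 1 = 5 already exceeds
        \<open>r_opt 11\<close>.\<close>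
      have "q \<noteq> 3" using le' 2 by auto
      with n m assms(2) 2 have "4 \<le> int q" by linarith
      then have "4 * int q \<le> int q * int q" by (intro mult_right_mono) auto
      with \<open>4 \<le> int q\<close> have "24 \<le> 6 * (int q * int q) - 18 * int q" by linarith
      with 2 show ?thesis by (simp add: mult.assoc)
    qed
  qed
  with bag_value_diff(1)[of k q] show ?thesis unfolding m by simp
next
  case False
  then obtain q where m: "m = 2 * q + 1" by (auto elim: oddE)
  have le': "4 * int k * int k + 16 * int q + 1 \<le> 8 * int q * int q + 12 * int k"
    using le unfolding n m by (simp add: power2_eq_square algebra_simps)
  \<comment> \<open>Three quarters of \<open>le'\<close> leave at least 6 q - 21/4, positive as soon
    as q is not 0.\<close>
  have "q \<noteq> 0"
  proof
    assume "q = 0"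
    with le' have "4 * int k * int k + 1 \<le> 12 * int k" by simp
    moreover have "3 * int k \<le> int k * int k" using assms(3) by (intro mult_right_mono) auto
    ultimately show False by linarith
  qed
  with le' have "0 < 6 * int q * int q - 3 * int k * int k + 9 * int k - 6 * int q - 6"
    by linarith
  with bag_value_diff(2)[of k q] show ?thesis unfolding m by simp
qed

text \<open>Three quarters of the expanded hypothesis again cancel the quadratic terms. What remains
  is at most -6 q - 21/4 for even \<open>m\<close> and at most -6 k + 45/4 for odd
  \<open>m\<close>.\<close>

lemma bag_value_decreasing:
  fixes k m n :: nat
  assumes n: "n = k + m + 1" and "3 \<le> k"
    and le: "(2 * int n - 11)\<^sup>2 \<le> 2 * (int k + int n - 8)\<^sup>2"
  shows "bag_value (k + 1) m < bag_value k (m + 1)"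
proof (cases "even m")
  case True
  then obtain q where m: "m = 2 * q" by (auto elim: evenE)
  have "8 * int q * int q + 20 * int k \<le> 4 * int k * int k + 16 * int q + 17"
    using le unfolding n m by (simp add: power2_eq_square algebra_simps)
  then have "6 * int q * int q - 3 * int k * int k + 15 * int k - 18 * int q - 18 < 0"
    by linarith
  with bag_value_diff(1)[of k q] show ?thesis unfolding m by simp
next
  case False
  then obtain q where m: "m = 2 * q + 1" by (auto elim: oddE)
  have "8 * int q * int q + 20 * int k \<le> 4 * int k * int k + 8 * int q + 23"
    using le unfolding n m by (simp add: power2_eq_square algebra_simps)
  then have "6 * int q * int q - 3 * int k * int k + 9 * int k - 6 * int q - 6 < 0"
    using assms(2) by linarith
  with bag_value_diff(2)[of k q] show ?thesis unfolding m by simp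
qed

text \<open>Comparing \<open>x\<close> with \<open>r_opt n\<close> amounts to comparing
  \<open>2 * (x + real n - 8)\<close> with \<open>sqrt 2 * (2 * real n - 11)\<close>. Both are
  nonnegative, so squaring keeps the order and leaves a condition that can be moved to the
  integers.\<close>

lemma r_opt_le_iff:
  fixes n :: nat and x :: real
  assumes "11 \<le> n" "0 \<le> x + real n - 8"
  shows "r_opt n \<le> x \<longleftrightarrow> (2 * real n - 11)\<^sup>2 \<le> 2 * (x + real n - 8)\<^sup>2"
    "x \<le> r_opt n \<longleftrightarrow> 2 * (x + real n - 8)\<^sup>2 \<le> (2 * real n - 11)\<^sup>2"
proof -
  define y z where "y = sqrt 2 * (2 * real n - 11)" and "z = 2 * (x + real n - 8)"
  have pos: "0 \<le> y" "0 \<le> z" using assms by (auto simp: y_def z_def)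
  have sq: "y\<^sup>2 = 2 * (2 * real n - 11)\<^sup>2" "z\<^sup>2 = 2 * (2 * (x + real n - 8)\<^sup>2)"
    unfolding y_def z_def power_mult_distrib by simp_all
  have r: "2 * r_opt n = y - 2 * real n + 16"
    by (simp add: y_def r_opt_def algebra_simps)
  have "r_opt n \<le> x \<longleftrightarrow> y \<le> z" "x \<le> r_opt n \<longleftrightarrow> z \<le> y"
    using r by (auto simp: z_def)
  moreover have "y \<le> z \<longleftrightarrow> y\<^sup>2 \<le> z\<^sup>2" "z \<le> y \<longleftrightarrow> z\<^sup>2 \<le> y\<^sup>2"
    using pos by (simp_all add: power2_le_iff_abs_le)
  ultimately show "r_opt n \<le> x \<longleftrightarrow> (2 * real n - 11)\<^sup>2 \<le> 2 * (x + real n - 8)\<^sup>2"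
    "x \<le> r_opt n \<longleftrightarrow> 2 * (x + real n - 8)\<^sup>2 \<le> (2 * real n - 11)\<^sup>2"
    unfolding sq by simp_all
qed

section \<open>Monotonicity of the price on either side of \<open>r_opt\<close>\<close>

lemma price_backward_bag_increasing:
  assumes "11 \<le> n" "3 \<le> k" "k + 1 < n" "real (k + 1) \<le> r_opt n"
  shows "price_of_symmetrisation (backward_bag n k) < price_of_symmetrisation (backward_bag n (k + 1))"
proof -
  have "2 * (real (k + 1) + real n - 8)\<^sup>2 \<le> (2 * real n - 11)\<^sup>2"
    using r_opt_le_iff(2)[of n "real (k + 1)"] assms by simp
  then have "real_of_int (2 * (int k + int n - 7)\<^sup>2) \<le> real_of_int ((2 * int n - 11)\<^sup>2)"
    by (simp add: algebra_simps)
  then have le: "2 * (int k + int n - 7)\<^sup>2 \<le> (2 * int n - 11)\<^sup>2" by (simp only: of_int_le_iff)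
  have n: "n = k + (n - (k + 1)) + 1" "n - k = n - (k + 1) + 1" using assms(3) by simp_all
  have "bag_value k (n - k) < bag_value (k + 1) (n - (k + 1))"
    using bag_value_increasing[OF n(1) assms(1,2) le] unfolding n(2) .
  with price_backward_bag[of k n] price_backward_bag[of "k + 1" n] assms show ?thesis by simp
qed

lemma price_backward_bag_decreasing:
  assumes "11 \<le> n" "3 \<le> k" "k + 1 < n" "r_opt n \<le> real k"
  shows "price_of_symmetrisation (backward_bag n (k + 1)) < price_of_symmetrisation (backward_bag n k)"
proof -
  have "(2 * real n - 11)\<^sup>2 \<le> 2 * (real k + real n - 8)\<^sup>2"
    using r_opt_le_iff(1)[of n "real k"] assms by simp
  then have "real_of_int ((2 * int n - 11)\<^sup>2) \<le> real_of_int (2 * (int k + int n - 8)\<^sup>2)"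
    by simp
  then have le: "(2 * int n - 11)\<^sup>2 \<le> 2 * (int k + int n - 8)\<^sup>2" by (simp only: of_int_le_iff)
  have n: "n = k + (n - (k + 1)) + 1" "n - k = n - (k + 1) + 1" using assms(3) by simp_all
  have "bag_value (k + 1) (n - (k + 1)) < bag_value k (n - k)"
    using bag_value_decreasing[OF n(1) assms(2) le] unfolding n(2) .
  with price_backward_bag[of k n] price_backward_bag[of "k + 1" n] assms show ?thesis by simp
qed

text \<open>This keeps floor and ceiling, and every step between them and an admissible order,
  within the range where the price formula holds.\<close>

lemma r_opt_bounds:
  assumes "11 \<le> n"
  shows "3 \<le> r_opt n" "r_opt n \<le> real n - 2"
proof -
  have "2 * (3 + real n - 8)\<^sup>2 \<le> (2 * real n - 11)\<^sup>2"
    "(2 * real n - 11)\<^sup>2 \<le> 2 * ((real n - 2) + real n - 8)\<^sup>2"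
  proof -
    \<comment> \<open>In terms of \<open>i\<close> both inequalities hold coefficient by
      coefficient.\<close>
    obtain i where "n = i + 11" using assms by (metis add.commute le_Suc_ex)
    then show "2 * (3 + real n - 8)\<^sup>2 \<le> (2 * real n - 11)\<^sup>2"
      "(2 * real n - 11)\<^sup>2 \<le> 2 * ((real n - 2) + real n - 8)\<^sup>2"
      by (simp_all add: power2_eq_square algebra_simps)
  qed
  then show "3 \<le> r_opt n" "r_opt n \<le> real n - 2"
    using r_opt_le_iff(2)[of n 3] r_opt_le_iff(1)[of n "real n - 2"] assms by simp_all
qed

lemma less_floor_r_opt:
  assumes "11 \<le> n" "3 \<le> k" "k < nat \<lfloor>r_opt n\<rfloor>"
  shows "price_of_symmetrisation (backward_bag n k) <
    price_of_symmetrisation (backward_bag n (nat \<lfloor>r_opt n\<rfloor>))"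
proof -
  have "price_of_symmetrisation (backward_bag n k) < price_of_symmetrisation (backward_bag n j)"
    if "k < j" "j \<le> nat \<lfloor>r_opt n\<rfloor>" for j
    using that
  proof (induction j)
    case (Suc j)
    have "real (j + 1) \<le> r_opt n" using Suc.prems(2) r_opt_bounds[OF assms(1)] by linarith
    then have "price_of_symmetrisation (backward_bag n j) < price_of_symmetrisation (backward_bag n (Suc j))"
      using price_backward_bag_increasing[of n j] r_opt_bounds[OF assms(1)] assms(1,2) Suc.prems(1)
      by simp
    with Suc show ?case by (cases "k = j") auto
  qed simp
  with assms(3) show ?thesis by simp
qed

lemma greater_ceiling_r_opt:
  assumes "11 \<le> n" "nat \<lceil>r_opt n\<rceil> < k" "k < n"
  shows "price_of_symmetrisation (backward_bag n k) <
    price_of_symmetrisation (backward_bag n (nat \<lceil>r_opt n\<rceil>))"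
  using assms(2,3)
proof (induction k)
  case (Suc k)
  have "r_opt n \<le> real k" "3 \<le> k" using Suc.prems(1) r_opt_bounds[OF assms(1)] by linarith+
  then have "price_of_symmetrisation (backward_bag n (Suc k)) < price_of_symmetrisation (backward_bag n k)"
    using price_backward_bag_decreasing[of n k] assms(1) Suc.prems(2) by simp
  with Suc show ?case by (cases "k = nat \<lceil>r_opt n\<rceil>") auto
qed simp

text \<open>If floor and ceiling tie, equality also holds at the maximiser other than
  \<open>k_star\<close>; hence the equality case is membership in \<open>is_k_star\<close>, and the
  literal \<open>k = k_star\<close> is claimed under uniqueness.\<close>

theorem theorem3:
  fixes n k k_star :: nat and T :: "'a pair_pre_digraph" and a :: "'a \<times> 'a"
  assumes "n \<ge> 11" and "3 \<le> k" and "k \<le> n - 1"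
    and "tournament T" and "strongly_connected (with_proj T)" and "card (pverts T) = k"
    and "a \<in> parcs T"
    and "is_k_star n k_star"
  shows "price_of_symmetrisation (bag n T k a) \<le> price_of_symmetrisation (backward_bag n k) \<and>
         price_of_symmetrisation (backward_bag n k) \<le> price_of_symmetrisation (backward_bag n k_star) \<and>
         (price_of_symmetrisation (backward_bag n k) = price_of_symmetrisation (backward_bag n k_star)
            \<longleftrightarrow> is_k_star n k) \<and>
         ((\<exists>!j. is_k_star n j) \<longrightarrow>
           (price_of_symmetrisation (backward_bag n k) = price_of_symmetrisation (backward_bag n k_star)
              \<longleftrightarrow> k = k_star))"
proof -
  define p where "p j = price_of_symmetrisation (backward_bag n j)" for j
  define lo hi where "lo = nat \<lfloor>r_opt n\<rfloor>" and "hi = nat \<lceil>r_opt n\<rceil>"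
  have kn: "k < n" using assms(1,3) by simp
  have star: "is_k_star n j \<longleftrightarrow> j \<in> {lo, hi} \<and> p lo \<le> p j \<and> p hi \<le> p j" for j
    unfolding is_k_star_def is_arg_max_def p_def lo_def hi_def by (auto simp: not_less)
  \<comment> \<open>No integer lies strictly between \<open>lo\<close> and \<open>hi\<close>, so any
    other order is below \<open>lo\<close> or above \<open>hi\<close>, where strict monotonicity
    applies.\<close>
  have "hi \<le> lo + 1" unfolding lo_def hi_def by linarith
  then have less: "p k < p lo \<or> p k < p hi" if "k \<notin> {lo, hi}"
    using that less_floor_r_opt[OF assms(1,2)] greater_ceiling_r_opt[OF assms(1) _ kn]
    unfolding p_def lo_def[symmetric] hi_def[symmetric]
    by (cases "k < lo") auto
  have le: "p k \<le> p k_star" and eq: "p k = p k_star \<longleftrightarrow> is_k_star n k"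
    using assms(8) less unfolding star by (cases "k \<in> {lo, hi}"; auto)+
  have "6 * price_of_symmetrisation (bag n T k a) \<le> 6 * p k"
    using price_bag_le[OF assms(4-7,2) kn] price_backward_bag[OF assms(2) kn] by (simp add: p_def)
  then have "price_of_symmetrisation (bag n T k a) \<le> p k" by simp
  moreover have "(\<exists>!j. is_k_star n j) \<longrightarrow> (p k = p k_star \<longleftrightarrow> k = k_star)"
    using eq assms(8) by blast
  ultimately show ?thesis using le eq unfolding p_def by blast
qed

end
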